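(* An $(\alpha,\beta)$-metric $F=\alpha\phi(s)$, $s=\beta/\alpha$, on a manifold of dimension $n\ge 3$ satisfies the $\sigma T$-condition ($\sigma_hT^h_{ijk}=0$, where $\sigma_h=\partial\sigma/\partial x^h$) if and only if (a) $\Phi+m^2\Psi=0$; (b) $m^2\Omega+3\Psi=0$; (c) $\sigma_j-\dfrac{\sigma_0}{s\alpha}\,b_j=0$, where $\sigma_0:=\sigma_iy^i$.
   Context: $(\alpha,\beta)$-metrics. $M$ is an $n$-dimensional smooth manifold with induced local coordinates $(x^i,y^i)$ on $TM$; $\alpha=\sqrt{a_{ij}(x)y^iy^j}$ is the norm of a Riemannian metric and $\beta=b_i(x)y^i$ is a 1-form. $(a^{ij})$ is the inverse of $(a_{ij})$, $b^i:=a^{ij}b_j$, $b^2:=b^ib_i$. An $(\alpha,\beta)$-metric is a function $F=\alpha\,\phi(s)$, $s:=\beta/\alpha$, on nonzero tangent vectors, where $\phi:(-b_0,b_0)\to\mathbb R$ is smooth ($b_0>0$). Standing assumptions: $\phi(t)>0$ and $\phi(t)-t\phi'(t)+(x^2-t^2)\phi''(t)>0$ for all real $t,x$ with $|t|<x<b_0$; almost regular metrics are allowed, i.e. the $\alpha$-norm of $\beta$ is only required to be $\le b_0$ at each point, and $\phi$ may be defined only on $(0,b_0)$. The choice $\phi(s)=k_1s+k_2\sqrt{b^2-s^2}$ ($k_1,k_2$ constants), for which $g_{ij}$ below is degenerate, is excluded. Primes denote derivatives in $s$. $T$-tensor. With $\dot\partial_i=\partial/\partial y^i$, $g_{ij}=\frac12\dot\partial_i\dot\partial_jF^2$,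 $(g^{ij})$ its inverse, $C_{ijk}=\frac12\dot\partial_kg_{ij}$, $C^s_{ij}=g^{sr}C_{rij}$, $C_{rijk}=\dot\partial_rC_{ijk}$, $\ell_i=\dot\partial_iF$, $$T_{rijk}=FC_{rijk}-F(C_{sij}C^s_{rk}+C_{sjr}C^s_{ik}+C_{sir}C^s_{jk})+C_{rij}\ell_k+C_{rik}\ell_j+C_{rjk}\ell_i+C_{ijk}\ell_r,$$ and $T^h_{ijk}:=g^{hr}T_{rijk}$. The space satisfies the $\sigma T$-condition if it admits a smooth function $\sigma(x)$ on $M$ such that $\sigma_hT^h_{ijk}=0$, $\sigma_h:=\partial\sigma/\partial x^h$; the $\sigma$ in condition (c) is this function. Put $m^2:=b^2-s^2$, $\rho:=\phi^2-s\phi\phi'$, $\rho_0:=\phi'^2+\phi\phi''$, $\rho_1:=\phi\phi'-s(\phi'^2+\phi\phi'')$, $$K_1:=\frac{\rho_1}{2\alpha(\rho+m^2\phi\phi'')},\qquad K_2:=\frac{\rho\rho_0'-2\rho_1\phi\phi''}{2\alpha\rho(\rho+m^2\phi\phi'')},$$ $$\Phi:=-\frac{\rho_1\phi}{2\alpha}(s+\alpha K_1m^2),\qquad \Psi:=\frac{\rho_1\phi'}{\alpha}-\frac{\rho_1^2\phi}{\alpha\rho}-\frac{s\rho_0'\phi}{2\alpha}-\frac{\rho_1\phi m^2K_2}{2},$$ $$\Omega:=\frac{\rho_0''\phi}{2\alpha}+\frac{2\rho_0'\phi'}{\alpha}-3\phi\left(K_2\Big(\rho_1+\frac{\rho_0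'm^2}{2}\Big)+\frac{\rho_1\rho_0'}{2\alpha\rho}\right).$$
   Formalization: Proved for a given σ that is constant on no nonempty open set and for F whose T-tensor vanishes identically over no nonempty open set (else false: constant σ with φ=1+s; φ=1). Directions need g_ij invertible; (c) is required only where s≠0. *)

theory Defs
  imports "HOL-Analysis.Analysis"
begin

section \<open>Smooth functions and manifolds in local coordinates\<close>

definition partial :: "'n::finite \<Rightarrow> (real^'n \<Rightarrow> real) \<Rightarrow> real^'n \<Rightarrow> real" where
  "partial i f x = deriv (\<lambda>t. f (x + t *\<^sub>R axis i 1)) 0"

fun Ck_on :: "nat \<Rightarrow> (real^'n::finite) set \<Rightarrow> (real^'n \<Rightarrow> real) \<Rightarrow> bool" where
  "Ck_on 0 S f \<longleftrightarrow> continuous_on S f"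
| "Ck_on (Suc k) S f \<longleftrightarrow> (\<forall>x\<in>S. f differentiable (at x)) \<and> (\<forall>i. Ck_on k S (partial i f))"

text \<open>Only used for open \<open>S\<close>.\<close>
definition smooth_on :: "(real^'n::finite) set \<Rightarrow> (real^'n \<Rightarrow> real) \<Rightarrow> bool" where
  "smooth_on S f \<longleftrightarrow> (\<forall>k. Ck_on k S f)"

text \<open>A chart is its domain together with its coordinate map.  The manifold is the whole type
  \<open>'m\<close>, and its dimension is the cardinality of \<open>'n\<close>.\<close>
type_synonym ('m, 'n) chart = "'m set \<times> ('m \<Rightarrow> (real, 'n) vec)"

definition chart_image :: "('m, 'n::finite) chart \<Rightarrow> (real^'n) set" where
  "chart_image c = snd c ` fst c"

definition chart_inv :: "('m, 'n::finite) chart \<Rightarrow> real^'n \<Rightarrow> 'm" where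
  "chart_inv c = inv_into (fst c) (snd c)"

definition transition :: "('m, 'n::finite) chart \<Rightarrow> ('m, 'n) chart \<Rightarrow> real^'n \<Rightarrow> real^'n" where
  "transition c d x = snd d (chart_inv c x)"

definition smooth_atlas ::
    "('m::{t2_space,second_countable_topology}, 'n::finite) chart set \<Rightarrow> bool" where
  "smooth_atlas A \<longleftrightarrow>
     (\<Union>c\<in>A. fst c) = UNIV \<and>
     (\<forall>c\<in>A. open (fst c) \<and> open (chart_image c) \<and>
            homeomorphism (fst c) (chart_image c) (snd c) (chart_inv c)) \<and>
     (\<forall>c\<in>A. \<forall>d\<in>A. \<forall>i. smooth_on (snd c ` (fst c \<inter> fst d)) (\<lambda>x. transition c d x $ i))"

definition smooth_fun ::
    "('m::{t2_space,second_countable_topology}, 'n::finite) chart set \<Rightarrow> ('m \<Rightarrow> real) \<Rightarrow> bool" where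
  "smooth_fun A f \<longleftrightarrow> (\<forall>c\<in>A. smooth_on (chart_image c) (f \<circ> chart_inv c))"

text \<open>The Jacobian entry \<open>\<partial>x\<^sub>d\<^sup>k / \<partial>x\<^sub>c\<^sup>i\<close> at the point \<open>p\<close>.\<close>
definition jac :: "('m, 'n::finite) chart \<Rightarrow> ('m, 'n) chart \<Rightarrow> 'm \<Rightarrow> 'n \<Rightarrow> 'n \<Rightarrow> real" where
  "jac c d p k i = partial i (\<lambda>x. transition c d x $ k) (snd c p)"

text \<open>Tensor fields are given by their components in every chart, as functions of the coordinates,
  subject to the tensorial transformation law.\<close>

definition riemannian_metric ::
    "('m::{t2_space,second_countable_topology}, 'n::finite) chart set
      \<Rightarrow> (('m, 'n) chart \<Rightarrow> real^'n \<Rightarrow> real^'n^'n) \<Rightarrow> bool" where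
  "riemannian_metric A a \<longleftrightarrow>
     (\<forall>c\<in>A. \<forall>i j. smooth_on (chart_image c) (\<lambda>x. a c x $ i $ j)) \<and>
     (\<forall>c\<in>A. \<forall>x\<in>chart_image c.
        (\<forall>i j. a c x $ i $ j = a c x $ j $ i) \<and>
        (\<forall>y. y \<noteq> 0 \<longrightarrow> (\<Sum>i\<in>UNIV. \<Sum>j\<in>UNIV. a c x $ i $ j * y $ i * y $ j) > 0)) \<and>
     (\<forall>c\<in>A. \<forall>d\<in>A. \<forall>p\<in>fst c \<inter> fst d. \<forall>i j.
        a c (snd c p) $ i $ j =
          (\<Sum>k\<in>UNIV. \<Sum>l\<in>UNIV. jac c d p k i * jac c d p l j * a d (snd d p) $ k $ l))"

definition one_form ::
    "('m::{t2_space,second_countable_topology}, 'n::finite) chart set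
      \<Rightarrow> (('m, 'n) chart \<Rightarrow> real^'n \<Rightarrow> real^'n) \<Rightarrow> bool" where
  "one_form A b \<longleftrightarrow>
     (\<forall>c\<in>A. \<forall>i. smooth_on (chart_image c) (\<lambda>x. b c x $ i)) \<and>
     (\<forall>c\<in>A. \<forall>d\<in>A. \<forall>p\<in>fst c \<inter> fst d. \<forall>i.
        b c (snd c p) $ i = (\<Sum>k\<in>UNIV. jac c d p k i * b d (snd d p) $ k))"


section \<open>The T-tensor\<close>

text \<open>All derivatives here are taken in the fibre variable \<open>y\<close>, so the definitions refer to the
  restriction \<open>F :: real^'n \<Rightarrow> real\<close> of a Finsler function to a single tangent space.\<close>

definition fund :: "(real^'n::finite \<Rightarrow> real) \<Rightarrow> real^'n \<Rightarrow> real^'n^'n" where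
  "fund F y = (\<chi> i j. 1/2 * partial i (partial j (\<lambda>z. (F z)\<^sup>2)) y)"

definition fund_inv :: "(real^'n::finite \<Rightarrow> real) \<Rightarrow> real^'n \<Rightarrow> real^'n^'n" where
  "fund_inv F y = matrix_inv (fund F y)"

definition cartan :: "(real^'n::finite \<Rightarrow> real) \<Rightarrow> 'n \<Rightarrow> 'n \<Rightarrow> 'n \<Rightarrow> real^'n \<Rightarrow> real" where
  "cartan F i j k y = 1/2 * partial k (\<lambda>z. fund F z $ i $ j) y"

text \<open>\<open>cartan_up F s i j\<close> is \<open>C\<^sup>s\<^sub>i\<^sub>j\<close>.\<close>
definition cartan_up :: "(real^'n::finite \<Rightarrow> real) \<Rightarrow> 'n \<Rightarrow> 'n \<Rightarrow> 'n \<Rightarrow> real^'n \<Rightarrow> real" where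
  "cartan_up F s i j y = (\<Sum>r\<in>UNIV. fund_inv F y $ s $ r * cartan F r i j y)"

definition T_tensor :: "(real^'n::finite \<Rightarrow> real) \<Rightarrow> 'n \<Rightarrow> 'n \<Rightarrow> 'n \<Rightarrow> 'n \<Rightarrow> real^'n \<Rightarrow> real" where
  "T_tensor F r i j k y =
     F y * partial r (cartan F i j k) y
     - F y * (\<Sum>s\<in>UNIV. cartan F s i j y * cartan_up F s r k y
                     + cartan F s j r y * cartan_up F s i k y
                     + cartan F s i r y * cartan_up F s j k y)
     + cartan F r i j y * partial k F y + cartan F r i k y * partial j F y
     + cartan F r j k y * partial i F y + cartan F i j k y * partial r F y"

text \<open>\<open>T_up F h i j k\<close> is \<open>T\<^sup>h\<^sub>i\<^sub>j\<^sub>k\<close>.\<close>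
definition T_up :: "(real^'n::finite \<Rightarrow> real) \<Rightarrow> 'n \<Rightarrow> 'n \<Rightarrow> 'n \<Rightarrow> 'n \<Rightarrow> real^'n \<Rightarrow> real" where
  "T_up F h i j k y = (\<Sum>r\<in>UNIV. fund_inv F y $ h $ r * T_tensor F r i j k y)"


section \<open>$(\alpha,\beta)$-metrics\<close>

text \<open>Here \<open>G\<close> and \<open>w\<close> are the components \<open>a\<^sub>i\<^sub>j(x)\<close> and \<open>b\<^sub>i(x)\<close> at a point.\<close>

definition alpha :: "real^'n^'n \<Rightarrow> real^'n::finite \<Rightarrow> real" where
  "alpha G y = sqrt (\<Sum>i\<in>UNIV. \<Sum>j\<in>UNIV. G $ i $ j * y $ i * y $ j)"

definition beta :: "real^'n \<Rightarrow> real^'n::finite \<Rightarrow> real" where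
  "beta w y = (\<Sum>i\<in>UNIV. w $ i * y $ i)"

definition sval :: "real^'n^'n \<Rightarrow> real^'n \<Rightarrow> real^'n::finite \<Rightarrow> real" where
  "sval G w y = beta w y / alpha G y"

definition bsq :: "real^'n^'n \<Rightarrow> real^'n::finite \<Rightarrow> real" where
  "bsq G w = (\<Sum>i\<in>UNIV. \<Sum>j\<in>UNIV. matrix_inv G $ i $ j * w $ i * w $ j)"

definition ab_metric :: "(real \<Rightarrow> real) \<Rightarrow> real^'n^'n \<Rightarrow> real^'n \<Rightarrow> real^'n::finite \<Rightarrow> real" where
  "ab_metric \<phi> G w y = alpha G y * \<phi> (sval G w y)"

text \<open>The interval \<open>I\<close> is the domain of \<open>\<phi>\<close>; values of \<open>\<phi>\<close> outside \<open>I\<close> are irrelevant.\<close>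
definition ab_function :: "real \<Rightarrow> real set \<Rightarrow> (real \<Rightarrow> real) \<Rightarrow> bool" where
  "ab_function b0 I \<phi> \<longleftrightarrow>
     b0 > 0 \<and> (I = {-b0<..<b0} \<or> I = {0<..<b0}) \<and>
     (\<forall>k. \<forall>t\<in>I. (deriv ^^ k) \<phi> differentiable (at t)) \<and>
     (\<forall>t\<in>I. \<phi> t > 0) \<and>
     (\<forall>t\<in>I. \<forall>x. \<bar>t\<bar> < x \<and> x < b0 \<longrightarrow>
        \<phi> t - t * deriv \<phi> t + (x\<^sup>2 - t\<^sup>2) * deriv (deriv \<phi>) t > 0)"

text \<open>The tangent vectors at which the metric and its T-tensor are defined.  Invertibility of
  \<open>g\<^sub>i\<^sub>j\<close> is automatic when \<open>b < b0\<close>; it can only fail in the almost regular case \<open>b = b0\<close>, where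
  \<open>\<phi> - s\<phi>' + (b\<^sup>2 - s\<^sup>2)\<phi>''\<close> may vanish at some \<open>s\<close> and neither \<open>g\<^sup>i\<^sup>j\<close> nor \<open>K\<^sub>1\<close>, \<open>K\<^sub>2\<close> exist.\<close>
definition ab_domain ::
    "real set \<Rightarrow> (real \<Rightarrow> real) \<Rightarrow> real^'n^'n \<Rightarrow> real^'n \<Rightarrow> (real^'n::finite) set" where
  "ab_domain I \<phi> G w =
     {y. y \<noteq> 0 \<and> sval G w y \<in> I \<and> invertible (fund (ab_metric \<phi> G w) y)}"

text \<open>The excluded functions \<open>\<phi>(s) = k\<^sub>1 s + k\<^sub>2 sqrt (b\<^sup>2 - s\<^sup>2)\<close>, with \<open>b2\<close> standing for \<open>b\<^sup>2\<close>.\<close>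
definition degenerate_phi :: "real set \<Rightarrow> real \<Rightarrow> (real \<Rightarrow> real) \<Rightarrow> bool" where
  "degenerate_phi I b2 \<phi> \<longleftrightarrow>
     (\<exists>k1 k2. \<forall>s\<in>I. s\<^sup>2 < b2 \<longrightarrow> \<phi> s = k1 * s + k2 * sqrt (b2 - s\<^sup>2))"

definition ab_space ::
    "('m::{t2_space,second_countable_topology}, 'n::finite) chart set
      \<Rightarrow> (('m, 'n) chart \<Rightarrow> real^'n \<Rightarrow> real^'n^'n) \<Rightarrow> (('m, 'n) chart \<Rightarrow> real^'n \<Rightarrow> real^'n)
      \<Rightarrow> real \<Rightarrow> real set \<Rightarrow> (real \<Rightarrow> real) \<Rightarrow> bool" where
  "ab_space A a b b0 I \<phi> \<longleftrightarrow>
     smooth_atlas A \<and> riemannian_metric A a \<and> one_form A b \<and> ab_function b0 I \<phi> \<and>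
     (\<forall>c\<in>A. \<forall>x\<in>chart_image c. sqrt (bsq (a c x) (b c x)) \<le> b0) \<and>
     (\<forall>c\<in>A. \<forall>x\<in>chart_image c. b c x \<noteq> 0 \<longrightarrow> \<not> degenerate_phi I (bsq (a c x) (b c x)) \<phi>)"

definition rho :: "(real \<Rightarrow> real) \<Rightarrow> real \<Rightarrow> real" where
  "rho \<phi> s = (\<phi> s)\<^sup>2 - s * \<phi> s * deriv \<phi> s"

definition rho0 :: "(real \<Rightarrow> real) \<Rightarrow> real \<Rightarrow> real" where
  "rho0 \<phi> s = (deriv \<phi> s)\<^sup>2 + \<phi> s * deriv (deriv \<phi>) s"

definition rho1 :: "(real \<Rightarrow> real) \<Rightarrow> real \<Rightarrow> real" where
  "rho1 \<phi> s = \<phi> s * deriv \<phi> s - s * ((deriv \<phi> s)\<^sup>2 + \<phi> s * deriv (deriv \<phi>) s)"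

text \<open>In the following functions \<open>m2\<close> stands for \<open>m\<^sup>2 = b\<^sup>2 - s\<^sup>2\<close> and \<open>al\<close> for \<open>\<alpha>\<close>.\<close>

definition K1 :: "(real \<Rightarrow> real) \<Rightarrow> real \<Rightarrow> real \<Rightarrow> real \<Rightarrow> real" where
  "K1 \<phi> m2 al s =
     rho1 \<phi> s / (2 * al * (rho \<phi> s + m2 * \<phi> s * deriv (deriv \<phi>) s))"

definition K2 :: "(real \<Rightarrow> real) \<Rightarrow> real \<Rightarrow> real \<Rightarrow> real \<Rightarrow> real" where
  "K2 \<phi> m2 al s =
     (rho \<phi> s * deriv (rho0 \<phi>) s - 2 * rho1 \<phi> s * \<phi> s * deriv (deriv \<phi>) s)
       / (2 * al * rho \<phi> s * (rho \<phi> s + m2 * \<phi> s * deriv (deriv \<phi>) s))"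

definition Phi :: "(real \<Rightarrow> real) \<Rightarrow> real \<Rightarrow> real \<Rightarrow> real \<Rightarrow> real" where
  "Phi \<phi> m2 al s = - (rho1 \<phi> s * \<phi> s / (2 * al)) * (s + al * K1 \<phi> m2 al s * m2)"

definition Psi :: "(real \<Rightarrow> real) \<Rightarrow> real \<Rightarrow> real \<Rightarrow> real \<Rightarrow> real" where
  "Psi \<phi> m2 al s =
     rho1 \<phi> s * deriv \<phi> s / al
     - (rho1 \<phi> s)\<^sup>2 * \<phi> s / (al * rho \<phi> s)
     - s * deriv (rho0 \<phi>) s * \<phi> s / (2 * al)
     - rho1 \<phi> s * \<phi> s * m2 * K2 \<phi> m2 al s / 2"

definition Omega :: "(real \<Rightarrow> real) \<Rightarrow> real \<Rightarrow> real \<Rightarrow> real \<Rightarrow> real" where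
  "Omega \<phi> m2 al s =
     deriv (deriv (rho0 \<phi>)) s * \<phi> s / (2 * al)
     + 2 * deriv (rho0 \<phi>) s * deriv \<phi> s / al
     - 3 * \<phi> s * (K2 \<phi> m2 al s * (rho1 \<phi> s + deriv (rho0 \<phi>) s * m2 / 2)
                  + rho1 \<phi> s * deriv (rho0 \<phi>) s / (2 * al * rho \<phi> s))"


section \<open>The $\sigma T$-condition and the conditions (a), (b), (c)\<close>

definition grad :: "('m, 'n::finite) chart \<Rightarrow> ('m \<Rightarrow> real) \<Rightarrow> 'n \<Rightarrow> real^'n \<Rightarrow> real" where
  "grad c \<sigma> h x = partial h (\<sigma> \<circ> chart_inv c) x"

definition sigma_T_condition ::
    "('m, 'n::finite) chart set
      \<Rightarrow> (('m, 'n) chart \<Rightarrow> real^'n \<Rightarrow> real^'n^'n) \<Rightarrow> (('m, 'n) chart \<Rightarrow> real^'n \<Rightarrow> real^'n)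
      \<Rightarrow> real set \<Rightarrow> (real \<Rightarrow> real) \<Rightarrow> ('m \<Rightarrow> real) \<Rightarrow> bool" where
  "sigma_T_condition A a b I \<phi> \<sigma> \<longleftrightarrow>
     (\<forall>c\<in>A. \<forall>x\<in>chart_image c. \<forall>y\<in>ab_domain I \<phi> (a c x) (b c x). \<forall>i j k.
        (\<Sum>h\<in>UNIV. grad c \<sigma> h x * T_up (ab_metric \<phi> (a c x) (b c x)) h i j k y) = 0)"

definition condition_a ::
    "('m, 'n::finite) chart set
      \<Rightarrow> (('m, 'n) chart \<Rightarrow> real^'n \<Rightarrow> real^'n^'n) \<Rightarrow> (('m, 'n) chart \<Rightarrow> real^'n \<Rightarrow> real^'n)
      \<Rightarrow> real set \<Rightarrow> (real \<Rightarrow> real) \<Rightarrow> bool" where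
  "condition_a A a b I \<phi> \<longleftrightarrow>
     (\<forall>c\<in>A. \<forall>x\<in>chart_image c. \<forall>y\<in>ab_domain I \<phi> (a c x) (b c x).
        (let al = alpha (a c x) y; s = sval (a c x) (b c x) y; m2 = bsq (a c x) (b c x) - s\<^sup>2
         in Phi \<phi> m2 al s + m2 * Psi \<phi> m2 al s = 0))"

definition condition_b ::
    "('m, 'n::finite) chart set
      \<Rightarrow> (('m, 'n) chart \<Rightarrow> real^'n \<Rightarrow> real^'n^'n) \<Rightarrow> (('m, 'n) chart \<Rightarrow> real^'n \<Rightarrow> real^'n)
      \<Rightarrow> real set \<Rightarrow> (real \<Rightarrow> real) \<Rightarrow> bool" where
  "condition_b A a b I \<phi> \<longleftrightarrow>
     (\<forall>c\<in>A. \<forall>x\<in>chart_image c. \<forall>y\<in>ab_domain I \<phi> (a c x) (b c x).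
        (let al = alpha (a c x) y; s = sval (a c x) (b c x) y; m2 = bsq (a c x) (b c x) - s\<^sup>2
         in m2 * Omega \<phi> m2 al s + 3 * Psi \<phi> m2 al s = 0))"

text \<open>Since \<open>s\<close> occurs in a denominator, directions with \<open>s = 0\<close> are left out explicitly
  (in Isabelle \<open>\<sigma>\<^sub>0 / 0 = 0\<close>, which would wrongly force \<open>\<sigma>\<^sub>j = 0\<close> there).\<close>
definition condition_c ::
    "('m, 'n::finite) chart set
      \<Rightarrow> (('m, 'n) chart \<Rightarrow> real^'n \<Rightarrow> real^'n^'n) \<Rightarrow> (('m, 'n) chart \<Rightarrow> real^'n \<Rightarrow> real^'n)
      \<Rightarrow> real set \<Rightarrow> (real \<Rightarrow> real) \<Rightarrow> ('m \<Rightarrow> real) \<Rightarrow> bool" where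
  "condition_c A a b I \<phi> \<sigma> \<longleftrightarrow>
     (\<forall>c\<in>A. \<forall>x\<in>chart_image c. \<forall>y\<in>ab_domain I \<phi> (a c x) (b c x).
        (let al = alpha (a c x) y; s = sval (a c x) (b c x) y;
             \<sigma>0 = (\<Sum>i\<in>UNIV. grad c \<sigma> i x * y $ i)
         in s \<noteq> 0 \<longrightarrow> (\<forall>j. grad c \<sigma> j x - \<sigma>0 / (s * al) * b c x $ j = 0)))"

text \<open>For a constant \<open>\<sigma>\<close>, or for a vanishing T-tensor (e.g. a Riemannian \<open>F\<close>), the equation
  \<open>\<sigma>\<^sub>h T\<^sup>h\<^sub>i\<^sub>j\<^sub>k = 0\<close> holds for trivial reasons and carries no information on \<open>\<phi>\<close>, respectively
  \<open>\<sigma>\<close>.  The next two definitions say that neither happens on any nonempty open set.\<close>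

definition nowhere_locally_constant :: "('m::topological_space \<Rightarrow> real) \<Rightarrow> bool" where
  "nowhere_locally_constant \<sigma> \<longleftrightarrow>
     (\<forall>W. open W \<and> W \<noteq> {} \<longrightarrow> \<not> (\<exists>r. \<forall>p\<in>W. \<sigma> p = r))"

definition T_nowhere_locally_zero ::
    "('m::topological_space, 'n::finite) chart set
      \<Rightarrow> (('m, 'n) chart \<Rightarrow> real^'n \<Rightarrow> real^'n^'n) \<Rightarrow> (('m, 'n) chart \<Rightarrow> real^'n \<Rightarrow> real^'n)
      \<Rightarrow> real set \<Rightarrow> (real \<Rightarrow> real) \<Rightarrow> bool" where
  "T_nowhere_locally_zero A a b I \<phi> \<longleftrightarrow>
     (\<forall>c\<in>A. \<forall>W. open W \<and> W \<noteq> {} \<and> W \<subseteq> fst c \<longrightarrow>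
        (\<exists>p\<in>W. let G = a c (snd c p); w = b c (snd c p) in
           \<exists>y\<in>ab_domain I \<phi> G w. \<exists>r i j k. T_tensor (ab_metric \<phi> G w) r i j k y \<noteq> 0))"

end

(* Write h for the angular metric of alpha and m_i = b_i - s alpha_i.  Differentiation in y gives
     T_rijk = Phi (h_ri h_jk + ...) + Psi (h_ri m_j m_k + ...) + Omega m_r m_i m_j m_k,
   with 3, 6 and 1 terms.  Let v be sigma_i raised by g.  If h v = c m, contracting T with v gives
     c (Phi + m^2 Psi) (m_i h_jk + ...) + c (m^2 Omega + 3 Psi) m_i m_j m_k,
   so (a) and (b) make it vanish; and h v is a multiple of m exactly when sigma_i lies in the span
   of b_i and the lowered y_i.  Conversely, let the contraction vanish.  Where m(v) is nonzero, (a) and (b)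
   hold.  The equation m(v) = 0 cannot hold on an open set of y unless d sigma = 0: its
   y-derivative puts sigma_i into the span of b_i and y_i for an open set of y, which forces
   sigma_i = t b_i as n >= 3, and then t = 0.  So (a) and (b) hold wherever d sigma is nonzero,
   and by the same span argument sigma_i is a multiple of b_i wherever T does not vanish identically in y.
   Both sets of points are dense, and the conclusions extend by continuity. *)
theory Submission
  imports Defs
begin

section \<open>Partial derivatives\<close>

text \<open>The difficulty of the converse is that at a single y with m(v) = 0 the contraction may
  vanish although (a) and (b) fail (for instance when v is parallel to y), so the equation m(v) = 0
  has to be differentiated in y, and v depends on y through g^-1. Symmetry of g turns it into an
  identity free of g^-1: \<alpha>\<phi> times the constant \<sigma>_i b^i equals (s\<phi> + m^2
  \<phi>') times \<sigma>_i y^i, whose y-gradient is explicit. Likewise g^-1 is nowhere computed as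
  a matrix; its action on m and on the rows of h suffices, because C contains no other covectors.
  Two degeneracies are kept apart. For b \<noteq> 0, m = 0 happens only for y parallel to the raised
  b and is avoided by density in y; for b = 0, T vanishes and (a), (b) hold trivially. Extension by
  continuity in the base point keeps the coordinates of y fixed and moves x.\<close>

definition has_partial ::
    "'n::finite \<Rightarrow> (real^'n \<Rightarrow> real) \<Rightarrow> real \<Rightarrow> real^'n \<Rightarrow> bool" where
  "has_partial i f D y \<longleftrightarrow> ((\<lambda>t. f (y + t *\<^sub>R axis i 1)) has_real_derivative D) (at 0)"

lemma partial_eqI: "has_partial i f D y \<Longrightarrow> partial i f y = D"
  unfolding has_partial_def partial_def by (rule DERIV_imp_deriv)

lemma has_partial_unique: "has_partial i f D y \<Longrightarrow> has_partial i f E y \<Longrightarrow> D = E"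
  unfolding has_partial_def by (rule DERIV_unique)

text \<open>Needed for iterated partials: the inner \<open>partial\<close> has a closed form only on
  an open set and is replaced by it before the next differentiation.\<close>

lemma has_partial_transform:
  assumes "open U" "y \<in> U" "\<And>z. z \<in> U \<Longrightarrow> f z = g z" "has_partial i g D y"
  shows "has_partial i f D y"
proof -
  have "((\<lambda>t. y + t *\<^sub>R axis i 1) \<longlongrightarrow> y + 0 *\<^sub>R axis i 1) (nhds 0)"
    by (intro tendsto_add tendsto_const tendsto_scaleR) (simp add: filterlim_ident)
  then have "eventually (\<lambda>t. y + t *\<^sub>R axis i 1 \<in> U) (nhds 0)"
    using assms(1,2) by (auto dest!: topological_tendstoD)
  then have E: "eventually (\<lambda>t. f (y + t *\<^sub>R axis i 1) = g (y + t *\<^sub>R axis i 1)) (nhds 0)"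
    by eventually_elim (use assms(3) in auto)
  show ?thesis
    using assms(4) DERIV_cong_ev[OF refl E refl] unfolding has_partial_def by simp
qed

lemma has_partial_eq: "has_partial i f D y \<Longrightarrow> D = E \<Longrightarrow> has_partial i f E y"
  by simp

lemma has_partial_const: "has_partial i (\<lambda>z. c) 0 y"
  unfolding has_partial_def by simp

lemma has_partial_add:
  "has_partial i f D y \<Longrightarrow> has_partial i g E y \<Longrightarrow> has_partial i (\<lambda>z. f z + g z) (D + E) y"
  unfolding has_partial_def by (rule DERIV_add)

lemma has_partial_diff:
  "has_partial i f D y \<Longrightarrow> has_partial i g E y \<Longrightarrow> has_partial i (\<lambda>z. f z - g z) (D - E) y"
  unfolding has_partial_def by (rule DERIV_diff)

lemma has_partial_mult:
  assumes "has_partial i f D y" "has_partial i g E y"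
  shows "has_partial i (\<lambda>z. f z * g z) (D * g y + E * f y) y"
  using DERIV_mult[OF assms[unfolded has_partial_def]] by (simp add: has_partial_def)

lemma has_partial_divide:
  assumes "has_partial i f D y" "has_partial i g E y" "g y \<noteq> 0"
  shows "has_partial i (\<lambda>z. f z / g z) ((D * g y - f y * E) / (g y * g y)) y"
  using DERIV_divide[OF assms(1,2)[unfolded has_partial_def]] assms(3)
  by (simp add: has_partial_def)

lemma has_partial_compose:
  assumes "(g has_real_derivative E) (at (f y))" "has_partial i f D y"
  shows "has_partial i (\<lambda>z. g (f z)) (E * D) y"
  using DERIV_chain2[where f = g and g = "\<lambda>t. f (y + t *\<^sub>R axis i 1)" and x = 0] assms
  by (simp add: has_partial_def)

lemma has_partial_inner: "has_partial i (\<lambda>z. p \<bullet> z) (p $ i) y"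
  unfolding has_partial_def inner_add_right inner_scaleR_right inner_axis
  by (auto intro!: derivative_eq_intros)

section \<open>The fibre geometry of an $(\alpha,\beta)$-metric\<close>

text \<open>A single tangent space: T involves only y-derivatives, so \<open>G\<close> and
  \<open>w\<close> are constants here. An arbitrary open \<open>I\<close> treats both admissible
  intervals at once.\<close>

locale ab_fibre =
  fixes G :: "real^'n::finite^'n" and w :: "real^'n" and I :: "real set" and \<phi> :: "real \<Rightarrow> real"
  assumes symG: "\<And>i j. G $ i $ j = G $ j $ i"
    and posG: "\<And>y. y \<noteq> 0 \<Longrightarrow> (\<Sum>i\<in>UNIV. \<Sum>j\<in>UNIV. G $ i $ j * y $ i * y $ j) > 0"
    and card3: "CARD('n) \<ge> 3"
    and open_I: "open I"
    and smooth_phi: "\<And>k t. t \<in> I \<Longrightarrow> (deriv ^^ k) \<phi> differentiable (at t)"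
    and phi_pos: "\<And>t. t \<in> I \<Longrightarrow> \<phi> t > 0"
begin

abbreviation "al \<equiv> alpha G"
abbreviation "sv \<equiv> sval G w"

text \<open>\<open>av\<close>, \<open>mv\<close> and \<open>hv\<close> are \<open>\<alpha>\<^sub>i = \<partial>\<alpha>/\<partial>y\<^sup>i\<close>, \<open>m\<^sub>i = b\<^sub>i - s\<alpha>\<^sub>i = \<alpha> \<partial>s/\<partial>y\<^sup>i\<close> and the angular metric
  \<open>h\<^sub>i\<^sub>j = a\<^sub>i\<^sub>j - \<alpha>\<^sub>i\<alpha>\<^sub>j\<close> of \<open>\<alpha>\<close>; the T-tensor turns out to be a combination of \<open>h\<close> and \<open>m\<close> alone.\<close>
definition av :: "real^'n \<Rightarrow> real^'n" where "av y = (1 / al y) *\<^sub>R (G *v y)"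
definition mv :: "real^'n \<Rightarrow> real^'n" where "mv y = w - sv y *\<^sub>R av y"
definition hv :: "real^'n \<Rightarrow> 'n \<Rightarrow> real^'n" where "hv y i = G $ i - av y $ i *\<^sub>R av y"

text \<open>Where F is smooth. Invertibility of g is left out, since deciding it requires the closed
  form of g, which is derived on \<open>U\<close>.\<close>

definition U :: "(real^'n) set" where "U = {y. y \<noteq> 0 \<and> sv y \<in> I}"

lemma quad_eq: "(\<Sum>i\<in>UNIV. \<Sum>j\<in>UNIV. G $ i $ j * y $ i * y $ j) = y \<bullet> (G *v y)"
  by (simp add: inner_vec_def matrix_vector_mult_def sum_distrib_left mult_ac)

lemma G_pos: "y \<noteq> 0 \<Longrightarrow> y \<bullet> (G *v y) > 0"
  using posG quad_eq by metis

lemma G_sym: "x \<bullet> (G *v y) = y \<bullet> (G *v x)"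
proof -
  have "transpose G = G" by (simp add: transpose_def vec_eq_iff symG)
  then show ?thesis by (metis dot_lmul_matrix inner_commute vector_transpose_matrix)
qed

lemma al_def': "al y = sqrt (y \<bullet> (G *v y))"
  by (simp add: alpha_def quad_eq)

lemma al_pos: "y \<noteq> 0 \<Longrightarrow> al y > 0"
  by (simp add: al_def' G_pos)

lemma al_sq: "al y * al y = y \<bullet> (G *v y)"
proof (cases "y = 0")
  case False
  then show ?thesis using G_pos[of y] by (simp add: al_def')
qed (simp add: al_def')

lemma sv_def': "sv y = (w \<bullet> y) / al y"
  by (simp add: sval_def beta_def inner_vec_def)

lemma isCont_al: "isCont al y"
proof -
  have "continuous_on UNIV (\<lambda>y. G *v y)" by (intro linear_continuous_on) (simp add: linear_linear)
  then have "isCont (\<lambda>y. G *v y) y" by (simp add: continuous_on_eq_continuous_at)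
  then show ?thesis unfolding al_def'[abs_def] by (intro continuous_intros)
qed

lemma isCont_sv: "y \<noteq> 0 \<Longrightarrow> isCont sv y"
  unfolding sv_def'[abs_def] using al_pos[of y] by (intro continuous_intros isCont_al) auto

lemma open_U: "open U"
proof (subst open_subopen, rule ballI)
  fix y assume "y \<in> U"
  then have y: "y \<noteq> 0" "sv y \<in> I" by (auto simp: U_def)
  have "(sv \<longlongrightarrow> sv y) (nhds y)"
    using isCont_sv[OF y(1)] by (simp add: isCont_def tendsto_at_iff_tendsto_nhds)
  then have "eventually (\<lambda>z. sv z \<in> I) (nhds y)"
    using open_I y(2) by (auto dest!: topological_tendstoD)
  moreover have "eventually (\<lambda>z. z \<noteq> 0) (nhds y)" by (rule t1_space_nhds[OF y(1)])
  ultimately have "eventually (\<lambda>z. z \<in> U) (nhds y)" by eventually_elim (simp add: U_def)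
  then show "\<exists>T. open T \<and> y \<in> T \<and> T \<subseteq> U" by (auto simp: eventually_nhds)
qed

lemma has_partial_al: 
  assumes "y \<noteq> 0" shows "has_partial i al (av y $ i) y"
proof -
  have eq: "(y + t *\<^sub>R axis i 1) \<bullet> (G *v (y + t *\<^sub>R axis i 1))
      = al y * al y + 2 * t * (G *v y) $ i + t * t * G $ i $ i" for t
    using G_sym[of y "axis i 1"]
    by (simp add: matrix_vector_right_distrib matrix_vector_mult_scaleR inner_add_left inner_add_right
        inner_axis' inner_axis algebra_simps al_sq matrix_vector_mult_basis column_def)
  have "((\<lambda>t. sqrt (al y * al y + 2 * t * (G *v y) $ i + t * t * G $ i $ i))
      has_real_derivative (av y $ i)) (at 0)"
    using al_pos[OF assms]
    by (auto intro!: derivative_eq_intros simp: av_def real_sqrt_mult field_simps)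
  then show ?thesis unfolding has_partial_def al_def'[of "y + _"] eq .
qed

lemma has_partial_sv:
  assumes "y \<noteq> 0" shows "has_partial i sv (mv y $ i / al y) y"
  unfolding sv_def'[abs_def]
  by (rule has_partial_eq[OF has_partial_divide[OF has_partial_inner has_partial_al]])
    (use assms al_pos[OF assms] in \<open>auto simp: mv_def sv_def' field_simps\<close>)

lemma has_partial_av:
  assumes "y \<noteq> 0" shows "has_partial i (\<lambda>z. av z $ j) (hv y i $ j / al y) y"
proof -
  have "(\<lambda>z. av z $ j) = (\<lambda>z. (G $ j \<bullet> z) / al z)"
    by (simp add: av_def matrix_vector_mul_component fun_eq_iff)
  then show ?thesis
    by (simp only:, intro has_partial_eq[OF has_partial_divide[OF has_partial_inner has_partial_al]])
      (use assms al_pos[OF assms] symG[of i j] in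
        \<open>auto simp: hv_def av_def matrix_vector_mul_component field_simps\<close>)
qed

lemma hv_sym: "hv y i $ j = hv y j $ i"
  by (simp add: hv_def symG[of i j])

text \<open>The y-derivatives of \<open>av\<close>, \<open>mv\<close> and \<open>hv\<close> are
  polynomials in these three and \<open>sv\<close>, divided by \<open>al\<close>; repeated
  differentiation never leaves this algebra.\<close>

lemma has_partial_mv:
  assumes "y \<noteq> 0"
  shows "has_partial i (\<lambda>z. mv z $ j) (- (mv y $ i * av y $ j + sv y * hv y i $ j) / al y) y"
proof -
  have eq: "(\<lambda>z. mv z $ j) = (\<lambda>z. w $ j - sv z * av z $ j)" by (simp add: mv_def)
  show ?thesis unfolding eq
    by (rule has_partial_eq[OF has_partial_diff[OF has_partial_const
          has_partial_mult[OF has_partial_sv[OF assms] has_partial_av[OF assms]]]])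
      (simp add: algebra_simps add_divide_distrib diff_divide_distrib)
qed

lemma has_partial_hv:
  assumes "y \<noteq> 0"
  shows "has_partial i (\<lambda>z. hv z j $ k) (- (hv y i $ j * av y $ k + hv y i $ k * av y $ j) / al y) y"
proof -
  have eq: "(\<lambda>z. hv z j $ k) = (\<lambda>z. G $ j $ k - av z $ j * av z $ k)" by (simp add: hv_def)
  show ?thesis unfolding eq
    by (rule has_partial_eq[OF has_partial_diff[OF has_partial_const
          has_partial_mult[OF has_partial_av[OF assms] has_partial_av[OF assms]]]])
      (simp add: algebra_simps add_divide_distrib diff_divide_distrib)
qed

abbreviation "f0 \<equiv> \<phi>"
abbreviation "f1 \<equiv> deriv \<phi>"
abbreviation "f2 \<equiv> deriv (deriv \<phi>)"
abbreviation "f3 \<equiv> deriv (deriv (deriv \<phi>))"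
abbreviation "f4 \<equiv> deriv (deriv (deriv (deriv \<phi>)))"

text \<open>T contains four y-derivatives of F^2, so derivatives of \<phi> up to the fourth
  occur.\<close>

lemma has_deriv_phi:
  assumes "t \<in> I"
  shows "(f0 has_real_derivative f1 t) (at t)" "(f1 has_real_derivative f2 t) (at t)"
    "(f2 has_real_derivative f3 t) (at t)" "(f3 has_real_derivative f4 t) (at t)"
  using smooth_phi[OF assms, of 0] smooth_phi[OF assms, of 1] smooth_phi[OF assms, of 2]
    smooth_phi[OF assms, of 3]
  by (simp_all add: numeral_2_eq_2 numeral_3_eq_3 DERIV_deriv_iff_real_differentiable)

lemma deriv_rho0: 
  assumes "t \<in> I"
  shows "(rho0 \<phi> has_real_derivative 3 * f1 t * f2 t + f0 t * f3 t) (at t)"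
  unfolding rho0_def[abs_def] using has_deriv_phi[OF assms]
  by (auto intro!: derivative_eq_intros simp: power2_eq_square)

abbreviation "r \<equiv> rho \<phi>"
abbreviation "r0 \<equiv> rho0 \<phi>"
abbreviation "r1 \<equiv> rho1 \<phi>"
abbreviation "r0' \<equiv> deriv (rho0 \<phi>)"
abbreviation "r0'' \<equiv> deriv (deriv (rho0 \<phi>))"

lemma r0'_eq: "t \<in> I \<Longrightarrow> r0' t = 3 * f1 t * f2 t + f0 t * f3 t"
  using deriv_rho0 by (rule DERIV_imp_deriv)

lemma has_deriv_r0: "t \<in> I \<Longrightarrow> (r0 has_real_derivative r0' t) (at t)"
  using deriv_rho0 r0'_eq by simp

lemma has_deriv_r0'_explicit:
  assumes "t \<in> I"
  shows "(r0' has_real_derivative 3 * f2 t * f2 t + 4 * f1 t * f3 t + f0 t * f4 t) (at t)"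
proof -
  have D: "((\<lambda>t. 3 * f1 t * f2 t + f0 t * f3 t) has_real_derivative
      3 * f2 t * f2 t + 4 * f1 t * f3 t + f0 t * f4 t) (at t)"
    by (rule derivative_eq_intros has_deriv_phi[OF assms] | simp)+
  have E: "eventually (\<lambda>u. r0' u = 3 * f1 u * f2 u + f0 u * f3 u) (nhds t)"
    using open_I assms r0'_eq by (auto simp: eventually_nhds)
  show ?thesis using DERIV_cong_ev[OF refl E refl] D by simp
qed

lemma r0''_eq: "t \<in> I \<Longrightarrow> r0'' t = 3 * f2 t * f2 t + 4 * f1 t * f3 t + f0 t * f4 t"
  using has_deriv_r0'_explicit by (rule DERIV_imp_deriv)

lemma has_deriv_r0': "t \<in> I \<Longrightarrow> (r0' has_real_derivative r0'' t) (at t)"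
  using has_deriv_r0'_explicit r0''_eq by simp

lemma isCont_r0'':
  assumes "t \<in> I" shows "isCont r0'' t"
proof -
  have "isCont f4 t"
    using smooth_phi[OF assms, of 4] by (simp add: numeral_eq_Suc differentiable_imp_continuous_within)
  then have "isCont (\<lambda>t. 3 * f2 t * f2 t + 4 * f1 t * f3 t + f0 t * f4 t) t"
    using has_deriv_phi[OF assms] by (intro continuous_intros) (auto dest: DERIV_isCont)
  moreover have "eventually (\<lambda>u. r0'' u = 3 * f2 u * f2 u + 4 * f1 u * f3 u + f0 u * f4 u) (nhds t)"
    using open_I assms r0''_eq by (auto simp: eventually_nhds)
  ultimately show ?thesis by (simp add: isCont_cong)
qed

text \<open>By this and the next three rules the coefficients of F^2, g and C differentiate into one
  another, which makes \<open>rho\<close>, \<open>rho0\<close> and \<open>rho1\<close> the natural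
  functions of s.\<close>

lemma has_deriv_r:
  assumes "t \<in> I" shows "(r has_real_derivative r1 t) (at t)"
  unfolding rho_def[abs_def] rho1_def using has_deriv_phi[OF assms]
  by (auto intro!: derivative_eq_intros simp: power2_eq_square algebra_simps)

lemma has_deriv_r1:
  assumes "t \<in> I" shows "(r1 has_real_derivative - t * r0' t) (at t)"
  unfolding rho1_def[abs_def] r0'_eq[OF assms] using has_deriv_phi[OF assms]
  by (auto intro!: derivative_eq_intros simp: power2_eq_square algebra_simps)

lemma has_deriv_ff1:
  assumes "t \<in> I" shows "((\<lambda>t. f0 t * f1 t) has_real_derivative r0 t) (at t)"
  unfolding rho0_def using has_deriv_phi[OF assms]
  by (auto intro!: derivative_eq_intros simp: power2_eq_square algebra_simps)

lemma has_deriv_ff: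
  assumes "t \<in> I" shows "((\<lambda>t. f0 t * f0 t) has_real_derivative 2 * (f0 t * f1 t)) (at t)"
  using has_deriv_phi[OF assms] by (auto intro!: derivative_eq_intros)

abbreviation "F \<equiv> ab_metric \<phi> G w"

lemma U_D: "y \<in> U \<Longrightarrow> y \<noteq> 0" "y \<in> U \<Longrightarrow> sv y \<in> I"
  by (auto simp: U_def)

lemma partial_F:
  assumes y: "y \<in> U"
  shows "partial i F y = f0 (sv y) * av y $ i + f1 (sv y) * mv y $ i"
proof (rule partial_eqI)
  show "has_partial i F (f0 (sv y) * av y $ i + f1 (sv y) * mv y $ i) y"
    unfolding ab_metric_def[abs_def] using U_D[OF y] al_pos[of y]
    by (intro has_partial_eq[OF has_partial_mult[OF has_partial_al
          has_partial_compose[OF has_deriv_phi(1) has_partial_sv]]]) (auto simp: field_simps)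
qed

lemma partial_F2:
  assumes y: "y \<in> U"
  shows "partial i (\<lambda>z. (F z)\<^sup>2) y
    = 2 * (al y * ((f0 (sv y) * f0 (sv y)) * av y $ i + (f0 (sv y) * f1 (sv y)) * mv y $ i))"
proof (rule partial_eqI)
  have eq: "(\<lambda>z. (F z)\<^sup>2) = (\<lambda>z. (al z * al z) * (f0 (sv z) * f0 (sv z)))"
    by (simp add: fun_eq_iff ab_metric_def power2_eq_square)
  have "has_partial i (\<lambda>z. f0 (sv z) * f0 (sv z)) (2 * (f0 (sv y) * f1 (sv y)) * (mv y $ i / al y)) y"
    using U_D[OF y] by (intro has_partial_compose[OF has_deriv_ff has_partial_sv])
  then show "has_partial i (\<lambda>z. (F z)\<^sup>2) 
      (2 * (al y * ((f0 (sv y) * f0 (sv y)) * av y $ i + (f0 (sv y) * f1 (sv y)) * mv y $ i))) y"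
    unfolding eq using U_D[OF y] al_pos[of y]
    by (intro has_partial_eq[OF has_partial_mult[OF has_partial_mult[OF has_partial_al has_partial_al]]])
     (auto simp: field_simps)
qed

text \<open>The tensor h arises twice, as \<phi>^2 h from differentiating \<open>av\<close> and as
  -s\<phi>\<phi>' h from differentiating \<open>mv\<close>; together this is \<rho> h.\<close>

lemma fund_eq:
  assumes y: "y \<in> U"
  shows "fund F y $ i $ j = r (sv y) * hv y i $ j + r0 (sv y) * (mv y $ i * mv y $ j)
    + (f0 (sv y) * f1 (sv y)) * (av y $ i * mv y $ j + mv y $ i * av y $ j)
    + (f0 (sv y) * f0 (sv y)) * (av y $ i * av y $ j)"
proof -
  have y0: "y \<noteq> 0" "sv y \<in> I" using U_D[OF y] by auto
  have "has_partial i (\<lambda>z. 2 * (al z * ((f0 (sv z) * f0 (sv z)) * av z $ j + (f0 (sv z) * f1 (sv z)) * mv z $ j)))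
    (2 * (r (sv y) * hv y i $ j + r0 (sv y) * (mv y $ i * mv y $ j)
    + (f0 (sv y) * f1 (sv y)) * (av y $ i * mv y $ j + mv y $ i * av y $ j)
    + (f0 (sv y) * f0 (sv y)) * (av y $ i * av y $ j))) y"
    using al_pos[OF y0(1)]
    by (intro has_partial_eq[OF has_partial_mult[OF has_partial_const has_partial_mult[OF has_partial_al
        has_partial_add[OF
          has_partial_mult[OF has_partial_compose[OF has_deriv_ff has_partial_sv] has_partial_av]
          has_partial_mult[OF has_partial_compose[OF has_deriv_ff1 has_partial_sv] has_partial_mv]]]]] y0)
     (simp add: field_simps rho_def power2_eq_square)
  from has_partial_transform[OF open_U y _ this, of "partial j (\<lambda>z. (F z)\<^sup>2)"]
  have "partial i (partial j (\<lambda>z. (F z)\<^sup>2)) y = 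
    (2 * (r (sv y) * hv y i $ j + r0 (sv y) * (mv y $ i * mv y $ j)
    + (f0 (sv y) * f1 (sv y)) * (av y $ i * mv y $ j + mv y $ i * av y $ j)
    + (f0 (sv y) * f0 (sv y)) * (av y $ i * av y $ j)))"
    by (intro partial_eqI) (simp add: partial_F2)
  then show ?thesis by (simp add: fund_def)
qed

text \<open>All terms in \<open>av\<close> cancel, in accordance with C_ijk y^k = 0: y annihilates h
  and m but not \<open>av\<close>.\<close>

lemma cartan_eq:
  assumes y: "y \<in> U"
  shows "cartan F i j k y = (r1 (sv y) * (hv y i $ j * mv y $ k + hv y i $ k * mv y $ j + hv y j $ k * mv y $ i)
     + r0' (sv y) * (mv y $ i * mv y $ j * mv y $ k)) / (2 * al y)"
proof -
  have y0: "y \<noteq> 0" "sv y \<in> I" using U_D[OF y] by auto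
  note c = has_partial_compose[OF _ has_partial_sv]
  note m = has_partial_mult
  have "has_partial k (\<lambda>y. r (sv y) * hv y i $ j + r0 (sv y) * (mv y $ i * mv y $ j)
    + (f0 (sv y) * f1 (sv y)) * (av y $ i * mv y $ j + mv y $ i * av y $ j)
    + (f0 (sv y) * f0 (sv y)) * (av y $ i * av y $ j))
    ((r1 (sv y) * (hv y i $ j * mv y $ k + hv y i $ k * mv y $ j + hv y j $ k * mv y $ i)
     + r0' (sv y) * (mv y $ i * mv y $ j * mv y $ k)) / al y) y"
    using al_pos[OF y0(1)]
    by (intro has_partial_eq[OF has_partial_add[OF has_partial_add[OF has_partial_add[OF
          m[OF c[OF has_deriv_r] has_partial_hv] 
          m[OF c[OF has_deriv_r0] m[OF has_partial_mv has_partial_mv]]]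
          m[OF c[OF has_deriv_ff1] has_partial_add[OF m[OF has_partial_av has_partial_mv] m[OF has_partial_mv has_partial_av]]]]
          m[OF c[OF has_deriv_ff] m[OF has_partial_av has_partial_av]]]] y0)
     (simp add: field_simps rho_def rho1_def rho0_def power2_eq_square hv_sym[of y k])
  from has_partial_transform[OF open_U y _ this, of "\<lambda>z. fund F z $ i $ j"]
  have "partial k (\<lambda>z. fund F z $ i $ j) y = 
    (r1 (sv y) * (hv y i $ j * mv y $ k + hv y i $ k * mv y $ j + hv y j $ k * mv y $ i)
     + r0' (sv y) * (mv y $ i * mv y $ j * mv y $ k)) / al y"
    by (intro partial_eqI) (simp add: fund_eq)
  then show ?thesis by (simp add: cartan_def)
qed

end

section \<open>Auxiliary linear algebra; Phi, Psi and Omega as fractions over Q and \<rho>\<close>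

lemma exists_orthogonal_pair:
  fixes x z :: "real^'n::finite"
  assumes "CARD('n) \<ge> 3"
  obtains p where "p \<noteq> 0" "x \<bullet> p = 0" "z \<bullet> p = 0"
proof -
  have "dim (span {x, z}) \<le> card {x, z}" by (simp add: dim_le_card')
  also have "\<dots> \<le> 2" by (simp add: card_insert_if)
  finally have "dim (span {x, z}) < DIM(real^'n)" using assms by simp
  then obtain p where p: "p \<noteq> 0" "\<And>q. q \<in> span {x, z} \<Longrightarrow> orthogonal p q"
    using orthogonal_to_subspace_exists[of "span {x, z}"] by (auto simp only: span_span)
  show ?thesis
    using p(1) p(2)[OF span_base, of x] p(2)[OF span_base, of z]
    by (intro that[of p]) (simp_all add: orthogonal_def inner_commute[of p])
qed

lemma matrix_inv_invertible:
  fixes A :: "'a::semiring_1^'n^'m"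
  assumes "invertible A"
  shows "A ** matrix_inv A = mat 1" "matrix_inv A ** A = mat 1"
  using assms someI_ex[of "\<lambda>B. A ** B = mat 1 \<and> B ** A = mat 1"]
  unfolding invertible_def matrix_inv_def by auto

text \<open>This and the next two rewritings show each coefficient as it comes out of T: a part from
  the derivative of C and the products of C with the gradient of F, minus a part from the products
  of two C, whose 1/Q and 1/\<rho> stem from g^-1.\<close>

lemma Phi_eq:
  assumes "al \<noteq> (0::real)" "rho \<phi> s \<noteq> 0" "Q = rho \<phi> s + m2 * \<phi> s * deriv (deriv \<phi>) s" "Q \<noteq> 0"
  shows "Phi \<phi> m2 al s = - (s * rho1 \<phi> s * \<phi> s / (2 * al)) - \<phi> s * (rho1 \<phi> s * rho1 \<phi> s) * m2 / (4 * al * Q)"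
  using assms(1,2,4) unfolding Phi_def K1_def assms(3)[symmetric]
  by (simp add: field_simps)

lemma Psi_eq:
  assumes "al \<noteq> (0::real)" "rho \<phi> s \<noteq> 0" "Q = rho \<phi> s + m2 * \<phi> s * deriv (deriv \<phi>) s" "Q \<noteq> 0"
  shows "Psi \<phi> m2 al s = rho1 \<phi> s * deriv \<phi> s / al - s * deriv (rho0 \<phi>) s * \<phi> s / (2 * al)
    - \<phi> s / (4 * al) * (rho1 \<phi> s * deriv (rho0 \<phi>) s * m2 / Q + 2 * (rho1 \<phi> s * rho1 \<phi> s) / Q
       + 2 * (rho1 \<phi> s * rho1 \<phi> s) / rho \<phi> s)"
proof -
  \<comment> \<open>Trading m^2 \<phi>\<phi>'' for Q - \<rho> splits the \<open>K2\<close> term into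
    fractions over Q and over \<rho>.\<close>
  have f2: "m2 * \<phi> s * deriv (deriv \<phi>) s = Q - rho \<phi> s" using assms(3) by simp
  have *: "rho1 \<phi> s * \<phi> s * m2 * K2 \<phi> m2 al s / 2 =
     rho1 \<phi> s * \<phi> s * (m2 * rho \<phi> s * deriv (rho0 \<phi>) s - 2 * rho1 \<phi> s * (m2 * \<phi> s * deriv (deriv \<phi>) s))
       / (4 * al * rho \<phi> s * Q)"
    using assms(1,2,4) unfolding K2_def assms(3)[symmetric] by (simp add: field_simps)
  show ?thesis unfolding Psi_def * f2
    using assms(1,2,4) by (simp add: field_simps power2_eq_square)
qed

text \<open>Here \<phi>'' stays: it occurs without a factor m^2, and m^2 can be zero, so it cannot
  be expressed by Q.\<close>

lemma Omega_eq:
  assumes "al \<noteq> (0::real)" "rho \<phi> s \<noteq> 0" "Q = rho \<phi> s + m2 * \<phi> s * deriv (deriv \<phi>) s" "Q \<noteq> 0"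
  shows "Omega \<phi> m2 al s = deriv (deriv (rho0 \<phi>)) s * \<phi> s / (2 * al) + 2 * deriv (rho0 \<phi>) s * deriv \<phi> s / al
    - 3 * \<phi> s / (4 * al) * (deriv (rho0 \<phi>) s * deriv (rho0 \<phi>) s * m2 / Q 
       + 4 * rho1 \<phi> s * deriv (rho0 \<phi>) s / Q
       - 4 * (rho1 \<phi> s * rho1 \<phi> s) * (\<phi> s * deriv (deriv \<phi>) s) / (rho \<phi> s * Q))"
proof -
  define c where "c = deriv (rho0 \<phi>) s"
  define e where "e = \<phi> s * deriv (deriv \<phi>) s"
  define p where "p = rho1 \<phi> s"
  define R where "R = rho \<phi> s"
  have Q: "Q = R + m2 * e" using assms(3) by (simp add: e_def R_def mult_ac)
  have nz: "R \<noteq> 0" "R + m2 * e \<noteq> 0" using assms(2,4) Q by (auto simp: R_def)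
  have "K2 \<phi> m2 al s * (p + c * m2 / 2) + p * c / (2 * al * R)
    = (c * c * m2 / Q + 4 * p * c / Q - 4 * (p * p) * e / (R * Q)) / (4 * al)"
  proof -
    have "K2 \<phi> m2 al s = (R * c - 2 * p * e) / (2 * al * R * Q)"
      unfolding K2_def assms(3)[symmetric] by (simp add: p_def c_def e_def R_def mult_ac)
    then have "K2 \<phi> m2 al s * (p + c * m2 / 2) + p * c / (2 * al * R)
        = ((R * c - 2 * p * e) * (p + c * m2 / 2) + p * c * Q) / (2 * al * R * Q)"
      using assms(1,4) nz by (simp add: add_divide_distrib)
    \<comment> \<open>The mixed terms \<open>p * c * m2 * e\<close> cancel because Q = R + m2 *
      e.\<close>
    also have "(R * c - 2 * p * e) * (p + c * m2 / 2) + p * c * Q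
        = 2 * R * c * p + R * c * c * m2 / 2 - 2 * p * p * e"
      unfolding Q by (simp add: algebra_simps)
    also have "(2 * R * c * p + R * c * c * m2 / 2 - 2 * p * p * e) / (2 * al * R * Q)
        = (c * c * m2 / Q + 4 * p * c / Q - 4 * (p * p) * e / (R * Q)) / (4 * al)"
      using assms(1,4) nz(1) by (simp add: field_simps)
    finally show ?thesis .
  qed
  then show ?thesis unfolding Omega_def p_def c_def R_def e_def by (simp add: mult_ac)
qed

context ab_fibre
begin

text \<open>The terms in \<open>a\<close> survive here; they cancel only in T, against the products
  of C with the gradient of F.\<close>

lemma partial_cartan:
  fixes y :: "real^'n"
  assumes y: "y \<in> U"
  defines "a \<equiv> \<lambda>i. av y $ i" and "m \<equiv> \<lambda>i. mv y $ i" and "h \<equiv> \<lambda>i j. hv y i $ j" and "s \<equiv> sv y"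
  shows "partial l (cartan F i j k) y = 
    (- s * r0' s * m l * (h i j * m k + h i k * m j + h j k * m i)
     - r1 s * ((h l i * a j + h l j * a i) * m k + h i j * (m l * a k + s * h l k)
       + (h l i * a k + h l k * a i) * m j + h i k * (m l * a j + s * h l j)
       + (h l j * a k + h l k * a j) * m i + h j k * (m l * a i + s * h l i))
     + r0'' s * (m l * m i * m j * m k)
     - r0' s * ((m l * a i + s * h l i) * m j * m k + (m l * a j + s * h l j) * m i * m k 
        + (m l * a k + s * h l k) * m i * m j)
     - (r1 s * (h i j * m k + h i k * m j + h j k * m i) + r0' s * (m i * m j * m k)) * a l)
    / (2 * al y * al y)" (is "_ = ?R")
proof -
  have y0: "y \<noteq> 0" "sv y \<in> I" using U_D[OF y] by auto
  note c = has_partial_compose[OF _ has_partial_sv]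
  note m = has_partial_mult
  have "has_partial l (\<lambda>y. (r1 (sv y) * (hv y i $ j * mv y $ k + hv y i $ k * mv y $ j + hv y j $ k * mv y $ i)
     + r0' (sv y) * (mv y $ i * mv y $ j * mv y $ k)) / (2 * al y)) ?R y"
    using al_pos[OF y0(1)]
    by (intro has_partial_eq[OF has_partial_divide[OF has_partial_add[OF
          m[OF c[OF has_deriv_r1] has_partial_add[OF has_partial_add[OF m[OF has_partial_hv has_partial_mv]
            m[OF has_partial_hv has_partial_mv]] m[OF has_partial_hv has_partial_mv]]]
          m[OF c[OF has_deriv_r0'] m[OF m[OF has_partial_mv has_partial_mv] has_partial_mv]]]
          m[OF has_partial_const has_partial_al]]] y0)
     (simp_all add: field_simps a_def m_def h_def s_def)
  from has_partial_transform[OF open_U y _ this, of "cartan F i j k"]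
  show ?thesis by (intro partial_eqI) (simp add: cartan_eq)
qed

section \<open>Raising indices, and inverting g on m and h\<close>

lemma inv_G: "invertible G"
proof -
  have "\<forall>x. G *v x = 0 \<longrightarrow> x = 0" using G_pos by fastforce
  then show ?thesis by (metis matrix_left_invertible_ker invertible_left_inverse)
qed

lemma G_mult_inv: "G *v (matrix_inv G *v x) = x"
  by (metis inv_G matrix_inv_invertible(1) matrix_vector_mul_assoc matrix_vector_mul_lid)

lemma bsq_eq: "bsq G w = w \<bullet> (matrix_inv G *v w)"
  by (simp add: bsq_def inner_vec_def matrix_vector_mult_def sum_distrib_left mult_ac)

text \<open>\<open>Nv\<close> is \<open>m\<close> raised by \<open>a\<close>, and \<open>hs y i\<close> is the \<open>i\<close>-th row of \<open>h\<close> raised by \<open>a\<close>.\<close>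
definition m2 :: "real^'n \<Rightarrow> real" where "m2 y = bsq G w - (sv y)\<^sup>2"
text \<open>Equal to \<phi> (\<phi> - s\<phi>' + m^2 \<phi>''). Together with \<rho> it controls
  degeneracy, since det g = \<rho>^(n-2) Q \<phi>^2 det a.\<close>

definition Q :: "real^'n \<Rightarrow> real" where "Q y = r (sv y) + m2 y * f0 (sv y) * f2 (sv y)"
definition Nv :: "real^'n \<Rightarrow> real^'n" where "Nv y = matrix_inv G *v w - (sv y / al y) *\<^sub>R y"
definition hs :: "real^'n \<Rightarrow> 'n \<Rightarrow> real^'n" where "hs y i = axis i 1 - (av y $ i / al y) *\<^sub>R y"

lemma av_y: "y \<noteq> 0 \<Longrightarrow> av y \<bullet> y = al y"
  using al_pos[of y] al_sq[of y] by (simp add: av_def inner_commute field_simps)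

lemma w_y: "y \<noteq> 0 \<Longrightarrow> w \<bullet> y = sv y * al y"
  using al_pos[of y] by (simp add: sv_def')

lemma mv_y: "y \<noteq> 0 \<Longrightarrow> mv y \<bullet> y = 0"
  by (simp add: mv_def inner_diff_left av_y w_y)

lemma Gi_inner: "G $ i \<bullet> x = (G *v x) $ i"
  by (simp add: matrix_vector_mul_component)

lemma hv_inner: "hv y i \<bullet> x = (G *v x) $ i - av y $ i * (av y \<bullet> x)"
  by (simp add: hv_def inner_diff_left Gi_inner)

lemma hv_y: "y \<noteq> 0 \<Longrightarrow> hv y i \<bullet> y = 0"
  using al_pos[of y] by (simp add: hv_inner av_y) (simp add: av_def)

lemma G_Nv: "y \<noteq> 0 \<Longrightarrow> G *v Nv y = mv y"
  by (simp add: Nv_def mv_def av_def matrix_vector_mult_diff_distrib G_mult_inv matrix_vector_mult_scaleR)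

lemma av_inner: "av y \<bullet> x = (y \<bullet> (G *v x)) / al y"
  by (simp add: av_def G_sym[of y x] inner_commute)

lemma av_Nv: "y \<noteq> 0 \<Longrightarrow> av y \<bullet> Nv y = 0"
  by (simp add: av_inner G_Nv inner_commute[of y] mv_y)

lemma mv_Nv: "y \<noteq> 0 \<Longrightarrow> mv y \<bullet> Nv y = m2 y"
  using al_pos[of y] mv_y[of y]
  by (simp add: Nv_def inner_diff_right inner_scaleR_right) 
    (simp add: mv_def inner_diff_left bsq_eq m2_def av_inner G_mult_inv w_y[unfolded inner_commute[of w]] power2_eq_square)

lemma hv_Nv: "y \<noteq> 0 \<Longrightarrow> hv y i \<bullet> Nv y = mv y $ i"
  by (simp add: hv_inner G_Nv av_Nv)

lemma mv_hs: "y \<noteq> 0 \<Longrightarrow> mv y \<bullet> hs y i = mv y $ i"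
  by (simp add: hs_def inner_diff_right mv_y inner_axis)

lemma av_hs: "y \<noteq> 0 \<Longrightarrow> av y \<bullet> hs y i = 0"
  using al_pos[of y] by (simp add: hs_def inner_diff_right av_y inner_axis)

lemma hv_hs: "y \<noteq> 0 \<Longrightarrow> hv y j \<bullet> hs y i = hv y j $ i"
  by (simp add: hs_def inner_diff_right hv_y inner_axis)

abbreviation "gm y \<equiv> fund F y"

lemma fund_mult:
  assumes y: "y \<in> U"
  shows "(gm y *v p) $ i = r (sv y) * (hv y i \<bullet> p) + r0 (sv y) * mv y $ i * (mv y \<bullet> p)
    + f0 (sv y) * f1 (sv y) * (av y $ i * (mv y \<bullet> p) + mv y $ i * (av y \<bullet> p))
    + f0 (sv y) * f0 (sv y) * av y $ i * (av y \<bullet> p)"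
proof -
  have "gm y $ i = r (sv y) *\<^sub>R hv y i + (r0 (sv y) * mv y $ i) *\<^sub>R mv y
    + (f0 (sv y) * f1 (sv y)) *\<^sub>R (av y $ i *\<^sub>R mv y + mv y $ i *\<^sub>R av y)
    + (f0 (sv y) * f0 (sv y) * av y $ i) *\<^sub>R av y"
    by (simp add: vec_eq_iff fund_eq[OF y] mult_ac)
  then show ?thesis
    by (simp add: matrix_vector_mul_component inner_add_left)
qed

lemma fund_sym: 
  assumes y: "y \<in> U" shows "transpose (gm y) = gm y"
proof -
  have "gm y $ j $ i = gm y $ i $ j" for i j
    using hv_sym[of y i j] by (simp add: fund_eq[OF y] algebra_simps)
  then show ?thesis by (simp add: transpose_def vec_eq_iff)
qed

text \<open>The multiples of \<open>y\<close> are chosen so that these vectors are annihilated by \<open>\<partial>F/\<partial>y\<^sup>i\<close>; hence lowering them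
  with \<open>g\<close> gives combinations of \<open>m\<close> and \<open>h\<close> again, and \<open>g\<close> can be inverted on these.\<close>
definition pm :: "real^'n \<Rightarrow> real^'n" where
  "pm y = Nv y - (f1 (sv y) * m2 y / F y) *\<^sub>R y"
definition ph :: "real^'n \<Rightarrow> 'n \<Rightarrow> real^'n" where
  "ph y i = hs y i - (f1 (sv y) * mv y $ i / F y) *\<^sub>R y"

lemma F_pos: "y \<in> U \<Longrightarrow> F y > 0"
  using U_D[of y] by (simp add: ab_metric_def al_pos phi_pos)

lemma F_eq: "F y = al y * f0 (sv y)" by (simp add: ab_metric_def)

lemma pm_inner:
  assumes y: "y \<in> U"
  shows "mv y \<bullet> pm y = m2 y" "hv y i \<bullet> pm y = mv y $ i" "av y \<bullet> pm y = - f1 (sv y) * m2 y / f0 (sv y)"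
  using U_D[OF y] al_pos[of y] phi_pos[of "sv y"]
  by (simp_all add: pm_def inner_diff_right mv_Nv hv_Nv av_Nv mv_y hv_y av_y F_eq)

lemma ph_inner:
  assumes y: "y \<in> U"
  shows "mv y \<bullet> ph y i = mv y $ i" "hv y j \<bullet> ph y i = hv y j $ i" "av y \<bullet> ph y i = - f1 (sv y) * mv y $ i / f0 (sv y)"
  using U_D[OF y] al_pos[of y] phi_pos[of "sv y"]
  by (simp_all add: ph_def inner_diff_right mv_hs hv_hs av_hs mv_y hv_y av_y F_eq)

text \<open>The y-component of \<open>pm\<close> cancels the \<open>av\<close> terms and turns
  \<rho>0 into \<rho>0 - \<phi>'^2 = \<phi>\<phi>''; this is where Q comes from.\<close>

lemma fund_pm:
  assumes y: "y \<in> U" shows "gm y *v pm y = Q y *\<^sub>R mv y"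
  using phi_pos[OF U_D(2)[OF y]]
  by (simp add: vec_eq_iff fund_mult[OF y] pm_inner[OF y] Q_def rho0_def field_simps power2_eq_square)

lemma fund_ph:
  assumes y: "y \<in> U" 
  shows "gm y *v ph y i = r (sv y) *\<^sub>R hv y i + (f0 (sv y) * f2 (sv y) * mv y $ i) *\<^sub>R mv y"
  using phi_pos[OF U_D(2)[OF y]]
  by (simp add: vec_eq_iff fund_mult[OF y] ph_inner[OF y] hv_sym[of y i] rho0_def field_simps power2_eq_square)

lemma fund_y:
  assumes y: "y \<in> U" 
  shows "gm y *v y = F y *\<^sub>R (f0 (sv y) *\<^sub>R av y + f1 (sv y) *\<^sub>R mv y)"
  using U_D(1)[OF y]
  by (simp add: vec_eq_iff fund_mult[OF y] hv_y mv_y av_y F_eq field_simps)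

lemma fund_inner_sym: "y \<in> U \<Longrightarrow> p \<bullet> (gm y *v q) = q \<bullet> (gm y *v p)"
  by (metis fund_sym dot_lmul_matrix inner_commute vector_transpose_matrix)

text \<open>If \<rho> = 0, every vector orthogonal to m and \<open>av\<close> is in the kernel; if Q
  = 0, \<open>pm\<close> is. Conversely, pairing g p = 0 with \<open>pm\<close> and with y gives
  m(p) = 0 and \<open>av\<close>(p) = 0, and what remains is \<rho> G p = 0.\<close>

lemma invertible_fund_iff:
  assumes y: "y \<in> U"
  shows "invertible (gm y) \<longleftrightarrow> r (sv y) \<noteq> 0 \<and> Q y \<noteq> 0"
proof -
  have ker: "invertible (gm y) \<longleftrightarrow> (\<forall>p. gm y *v p = 0 \<longrightarrow> p = 0)"
    by (simp add: invertible_left_inverse matrix_left_invertible_ker)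
  have y0: "y \<noteq> 0" "sv y \<in> I" using U_D[OF y] by auto
  show ?thesis
  proof
    assume inv: "invertible (gm y)"
    have r: "r (sv y) \<noteq> 0"
    proof
      assume r0: "r (sv y) = 0"
      \<comment> \<open>Dimension at least 3 leaves room for a direction orthogonal to both, on
        which g acts as \<rho> h.\<close>
      obtain p where p: "p \<noteq> 0" "mv y \<bullet> p = 0" "av y \<bullet> p = 0"
        using exists_orthogonal_pair[OF card3] by blast
      then have "gm y *v p = 0" by (simp add: vec_eq_iff fund_mult[OF y] r0)
      then show False using inv ker p(1) by blast
    qed
    moreover have "Q y \<noteq> 0"
    proof
      assume Q: "Q y = 0"
      then have "pm y = 0" using inv ker fund_pm[OF y] by simp
      \<comment> \<open>\<open>pm y\<close> can only vanish where m^2 = 0, and there Q =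
        \<rho>.\<close>
      then have "m2 y = 0" using pm_inner(1)[OF y] by simp
      then show False using Q r by (simp add: Q_def)
    qed
    ultimately show "r (sv y) \<noteq> 0 \<and> Q y \<noteq> 0" by simp
  next
    assume nz: "r (sv y) \<noteq> 0 \<and> Q y \<noteq> 0"
    show "invertible (gm y)" unfolding ker
    proof (intro allI impI)
      fix p assume p: "gm y *v p = 0"
      have "Q y * (mv y \<bullet> p) = 0"
        using fund_inner_sym[OF y, of "pm y" p] fund_pm[OF y] p by (simp add: inner_commute)
      then have m: "mv y \<bullet> p = 0" using nz by simp
      have "F y * (f0 (sv y) * (av y \<bullet> p)) = 0"
        using fund_inner_sym[OF y, of y p] fund_y[OF y] p m 
        by (simp add: inner_commute inner_add_right)
      then have a: "av y \<bullet> p = 0" using F_pos[OF y] phi_pos[OF y0(2)] by simp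
      have "(G *v p) $ i = 0" for i
        using fund_mult[OF y, of p i] p nz m a by (simp add: hv_inner)
      then have "p \<bullet> (G *v p) = 0" by (simp add: inner_vec_def)
      then show "p = 0" using G_pos by fastforce
    qed
  qed
qed

definition D :: "(real^'n) set" where "D = ab_domain I \<phi> G w"

lemma D_iff: "y \<in> D \<longleftrightarrow> y \<noteq> 0 \<and> sv y \<in> I \<and> r (sv y) \<noteq> 0 \<and> Q y \<noteq> 0"
  using invertible_fund_iff[of y] by (auto simp: D_def ab_domain_def U_def)

lemma D_U: "y \<in> D \<Longrightarrow> y \<in> U" by (simp add: D_iff U_def)

abbreviation "W y \<equiv> fund_inv F y"

lemma W_fund:
  assumes "y \<in> D" shows "W y *v (gm y *v p) = p" "gm y *v (W y *v p) = p"
proof -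
  have "invertible (gm y)" using assms by (simp add: D_def ab_domain_def)
  then show "W y *v (gm y *v p) = p" "gm y *v (W y *v p) = p"
    by (simp_all add: fund_inv_def matrix_vector_mul_assoc matrix_inv_invertible)
qed

lemma W_mv:
  assumes "y \<in> D" shows "W y *v mv y = (1 / Q y) *\<^sub>R pm y"
proof -
  have "mv y = gm y *v ((1 / Q y) *\<^sub>R pm y)"
    using assms by (simp add: fund_pm D_U matrix_vector_mult_scaleR D_iff)
  then show ?thesis using W_fund(1)[OF assms] by metis
qed

lemma W_hv:
  assumes y: "y \<in> D" 
  shows "W y *v hv y i = (1 / r (sv y)) *\<^sub>R (ph y i - (f0 (sv y) * f2 (sv y) * mv y $ i / Q y) *\<^sub>R pm y)"
proof -
  have "hv y i = gm y *v ((1 / r (sv y)) *\<^sub>R (ph y i - (f0 (sv y) * f2 (sv y) * mv y $ i / Q y) *\<^sub>R pm y))"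
    using y by (simp add: fund_pm fund_ph D_U matrix_vector_mult_scaleR matrix_vector_mult_diff_distrib D_iff)
  then show ?thesis using W_fund(1)[OF y] by metis
qed

lemma W_inner:
  assumes y: "y \<in> D"
  shows "mv y \<bullet> (W y *v mv y) = m2 y / Q y"
    "hv y i \<bullet> (W y *v mv y) = mv y $ i / Q y"
    "mv y \<bullet> (W y *v hv y i) = mv y $ i / Q y"
    "hv y i \<bullet> (W y *v hv y j) = (hv y i $ j - f0 (sv y) * f2 (sv y) * mv y $ i * mv y $ j / Q y) / r (sv y)"
proof -
  have nz: "r (sv y) \<noteq> 0" "Q y \<noteq> 0" using y by (auto simp: D_iff)
  show "mv y \<bullet> (W y *v mv y) = m2 y / Q y"
    "hv y i \<bullet> (W y *v mv y) = mv y $ i / Q y"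
    by (simp_all add: W_mv[OF y] pm_inner[OF D_U[OF y]])
  show "hv y i \<bullet> (W y *v hv y j) = (hv y i $ j - f0 (sv y) * f2 (sv y) * mv y $ i * mv y $ j / Q y) / r (sv y)"
    by (simp add: W_hv[OF y] pm_inner[OF D_U[OF y]] ph_inner[OF D_U[OF y]] inner_diff_right mult_ac)
  have "mv y \<bullet> (W y *v hv y i) = mv y $ i * (Q y - m2 y * f0 (sv y) * f2 (sv y)) / (r (sv y) * Q y)"
    using nz by (simp add: W_hv[OF y] pm_inner[OF D_U[OF y]] ph_inner[OF D_U[OF y]] inner_diff_right field_simps)
  \<comment> \<open>Q - m^2 \<phi>\<phi>'' = \<rho>, so the factor 1/\<rho> disappears.\<close>
  also have "\<dots> = mv y $ i / Q y" using nz(1) by (simp add: Q_def)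
  finally show "mv y \<bullet> (W y *v hv y i) = mv y $ i / Q y" .
qed

text \<open>For fixed i, j the Cartan tensor is a covector in the span of m and the rows i, j of h,
  so the sum is the form g^-1 on two such covectors and \<open>W_inner\<close> supplies all its
  values.\<close>

lemma cartan_sum:
  fixes y :: "real^'n"
  assumes y: "y \<in> D"
  defines "m \<equiv> \<lambda>i. mv y $ i" and "h \<equiv> \<lambda>i j. hv y i $ j" and "s \<equiv> sv y"
  shows "(\<Sum>t\<in>UNIV. cartan F t i j y * cartan_up F t l k y) =
    ((r1 s * h i j + r0' s * m i * m j) * (r1 s * h l k + r0' s * m l * m k) * (m2 y / Q y)
     + 2 * r1 s * (r1 s * h i j + r0' s * m i * m j) * m l * m k / Q y
     + 2 * r1 s * (r1 s * h l k + r0' s * m l * m k) * m i * m j / Q y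
     + r1 s * r1 s * ((h i l - f0 s * f2 s * m i * m l / Q y) * m j * m k
        + (h i k - f0 s * f2 s * m i * m k / Q y) * m j * m l
        + (h j l - f0 s * f2 s * m j * m l / Q y) * m i * m k
        + (h j k - f0 s * f2 s * m j * m k / Q y) * m i * m l) / r s) / (4 * al y * al y)"
proof -
  define C where "C i j = (\<chi> t. cartan F t i j y)" for i j
  define A where "A i j = r1 s * h i j + r0' s * m i * m j" for i j
  have C: "C i j = (1 / (2 * al y)) *\<^sub>R (A i j *\<^sub>R mv y 
    + (r1 s * m j) *\<^sub>R hv y i + (r1 s * m i) *\<^sub>R hv y j)" for i j
  proof -
    have "cartan F t i j y = (1 / (2 * al y)) * (A i j * mv y $ t
      + (r1 s * m j) * hv y i $ t + (r1 s * m i) * hv y j $ t)" for t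
      unfolding cartan_eq[OF D_U[OF y]] A_def m_def h_def s_def hv_sym[of y t i] hv_sym[of y t j]
      by (simp add: algebra_simps add_divide_distrib)
    then show ?thesis by (simp add: C_def vec_eq_iff)
  qed
  define e where "e = f0 s * f2 s / Q y"
  have hh: "hv y i $ j = h i j" for i j by (simp add: h_def)
  have "(\<Sum>t\<in>UNIV. cartan F t i j y * cartan_up F t l k y) = C i j \<bullet> (W y *v C l k)"
    by (simp add: inner_vec_def C_def cartan_up_def matrix_vector_mult_def)
  also have "\<dots> = (1 / (2 * al y)) * (1 / (2 * al y)) *
     (A i j * A l k * (m2 y / Q y)
     + A i j * (r1 s * m k) * (m l / Q y)
     + A i j * (r1 s * m l) * (m k / Q y)
     + (r1 s * m j) * (A l k * (m i / Q y)
       + (r1 s * m k) * ((h i l - e * m i * m l) / r s)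
       + (r1 s * m l) * ((h i k - e * m i * m k) / r s))
     + (r1 s * m i) * (A l k * (m j / Q y)
       + (r1 s * m k) * ((h j l - e * m j * m l) / r s)
       + (r1 s * m l) * ((h j k - e * m j * m k) / r s)))"
    unfolding C matrix_vector_right_distrib matrix_vector_mult_scaleR inner_add_left inner_add_right
      inner_scaleR_left inner_scaleR_right W_inner[OF y]
      m_def[symmetric] hh s_def[symmetric] e_def
    by (simp add: distrib_left distrib_right mult_ac add_ac)
  also have "\<dots> = (A i j * A l k * (m2 y / Q y)
     + 2 * r1 s * A i j * m l * m k / Q y
     + 2 * r1 s * A l k * m i * m j / Q y
     + r1 s * r1 s * ((h i l - e * m i * m l) * m j * m k
        + (h i k - e * m i * m k) * m j * m l
        + (h j l - e * m j * m l) * m i * m k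
        + (h j k - e * m j * m k) * m i * m l) / r s) / (4 * al y * al y)"
  proof -
    \<comment> \<open>With quotients written as products by reciprocals, the claim is a polynomial
      identity in which the reciprocals are variables.\<close>
    have d: "x / Q y = x * (1 / Q y)" "x / r s = x * (1 / r s)"
      "x / (4 * al y * al y) = x * (1 / (2 * al y)) * (1 / (2 * al y))" for x by simp_all
    show ?thesis unfolding d[of "m _"] d[of "_ * _"] d[of "m2 _"] d[of "_ + _"] d[of "_ - _"] by algebra
  qed
  finally have *: "(\<Sum>t\<in>UNIV. cartan F t i j y * cartan_up F t l k y) = \<dots>" .
  have e: "f0 s * f2 s * a * b / Q y = e * a * b" for a b by (simp add: e_def)
  show ?thesis unfolding e A_def[symmetric] by (rule *)
qed

end

section \<open>The T-tensor of an $(\alpha,\beta)$-metric\<close>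

text \<open>The part of T without products of two C, multiplied by 2\<alpha>; \<open>f\<close>,
  \<open>f1\<close>, \<open>c\<close>, \<open>d\<close> stand for \<phi>, \<phi>', \<rho>0',
  \<rho>0''. The gradient of F is \<phi> \<open>av\<close> + \<phi>' m, and its \<phi> part removes
  all terms in \<open>av\<close>.\<close>

lemma T_algebra_linear:
  fixes hij :: real
  shows "f * (- s * c * ml * (hij * mk + hik * mj + hjk * mi)
     - r1 * ((hli * aj + hlj * ai) * mk + hij * (ml * ak + s * hlk)
       + (hli * ak + hlk * ai) * mj + hik * (ml * aj + s * hlj)
       + (hlj * ak + hlk * aj) * mi + hjk * (ml * ai + s * hli))
     + d * (ml * mi * mj * mk)
     - c * ((ml * ai + s * hli) * mj * mk + (ml * aj + s * hlj) * mi * mk 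
        + (ml * ak + s * hlk) * mi * mj)
     - (r1 * (hij * mk + hik * mj + hjk * mi) + c * (mi * mj * mk)) * al)
    + (r1 * (hli * mj + hlj * mi + hij * ml) + c * (ml * mi * mj)) * (f * ak + f1 * mk)
    + (r1 * (hli * mk + hlk * mi + hik * ml) + c * (ml * mi * mk)) * (f * aj + f1 * mj)
    + (r1 * (hlj * mk + hlk * mj + hjk * ml) + c * (ml * mj * mk)) * (f * ai + f1 * mi)
    + (r1 * (hij * mk + hik * mj + hjk * mi) + c * (mi * mj * mk)) * (f * al + f1 * ml)
   = - s * r1 * f * (hli * hjk + hlj * hik + hlk * hij)
     + (2 * r1 * f1 - s * c * f) * (hli * mj * mk + hlj * mi * mk + hlk * mi * mj
        + hij * ml * mk + hik * ml * mj + hjk * ml * mi)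
     + (d * f + 4 * c * f1) * (ml * mi * mj * mk)"
  by algebra

text \<open>The three products of two C, multiplied by 4\<alpha>^2. The variables
  \<open>m2Q\<close>, \<open>iQ\<close>, \<open>ir\<close>, \<open>e\<close> stand for m^2/Q, 1/Q,
  1/\<rho>, \<phi>\<phi>''/Q and may be treated as independent.\<close>

lemma T_algebra_quadratic:
  fixes hij :: real
  shows "((r1 * hij + c * mi * mj) * (r1 * hlk + c * ml * mk) * m2Q
     + 2 * r1 * (r1 * hij + c * mi * mj) * ml * mk * iQ
     + 2 * r1 * (r1 * hlk + c * ml * mk) * mi * mj * iQ
     + r1 * r1 * ((hli - e * mi * ml) * mj * mk
        + (hik - e * mi * mk) * mj * ml
        + (hlj - e * mj * ml) * mi * mk
        + (hjk - e * mj * mk) * mi * ml) * ir)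
   + ((r1 * hlj + c * mj * ml) * (r1 * hik + c * mi * mk) * m2Q
     + 2 * r1 * (r1 * hlj + c * mj * ml) * mi * mk * iQ
     + 2 * r1 * (r1 * hik + c * mi * mk) * mj * ml * iQ
     + r1 * r1 * ((hij - e * mj * mi) * ml * mk
        + (hjk - e * mj * mk) * ml * mi
        + (hli - e * ml * mi) * mj * mk
        + (hlk - e * ml * mk) * mj * mi) * ir)
   + ((r1 * hli + c * mi * ml) * (r1 * hjk + c * mj * mk) * m2Q
     + 2 * r1 * (r1 * hli + c * mi * ml) * mj * mk * iQ
     + 2 * r1 * (r1 * hjk + c * mj * mk) * mi * ml * iQ
     + r1 * r1 * ((hij - e * mi * mj) * ml * mk
        + (hik - e * mi * mk) * ml * mj
        + (hlj - e * ml * mj) * mi * mk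
        + (hlk - e * ml * mk) * mi * mj) * ir)
   = r1 * r1 * m2Q * (hli * hjk + hlj * hik + hlk * hij)
     + (r1 * c * m2Q + 2 * r1 * r1 * iQ + 2 * r1 * r1 * ir) * (hli * mj * mk + hlj * mi * mk + hlk * mi * mj
        + hij * ml * mk + hik * ml * mj + hjk * ml * mi)
     + 3 * (c * c * m2Q + 4 * r1 * c * iQ - 4 * r1 * r1 * e * ir) * (ml * mi * mj * mk)"
  by algebra

lemma combine_coefficients:
  fixes p q :: real
  shows "(x1 * a + x2 * b + x3 * c) / p - f * (y1 * a + y2 * b + y3 * c) / q =
    (x1 / p - f * y1 / q) * a + (x2 / p - f * y2 / q) * b + (x3 / p - f * y3 / q) * c"
  by (simp add: add_divide_distrib algebra_simps)

context ab_fibre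
begin

abbreviation "PhiV y \<equiv> Phi \<phi> (m2 y) (al y) (sv y)"
abbreviation "PsiV y \<equiv> Psi \<phi> (m2 y) (al y) (sv y)"
abbreviation "OmegaV y \<equiv> Omega \<phi> (m2 y) (al y) (sv y)"

lemma T_tensor_eq:
  fixes y :: "real^'n"
  assumes y: "y \<in> D"
  defines "m \<equiv> \<lambda>i. mv y $ i" and "h \<equiv> \<lambda>i j. hv y i $ j"
  shows "T_tensor F l i j k y =
    PhiV y * (h l i * h j k + h l j * h i k + h l k * h i j)
    + PsiV y * (h l i * m j * m k + h l j * m i * m k + h l k * m i * m j
        + h i j * m l * m k + h i k * m l * m j + h j k * m l * m i)
    + OmegaV y * (m l * m i * m j * m k)"
proof -
  define s where "s = sv y"
  define a where "a = (\<lambda>i. av y $ i)"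
  have nz: "r s \<noteq> 0" "Q y \<noteq> 0" "al y \<noteq> 0" using y al_pos[of y] by (auto simp: D_iff s_def)
  note yU = D_U[OF y]
  have mm: "mv y $ i = m i" for i by (simp add: m_def)
  have hh: "hv y i $ j = h i j" for i j by (simp add: h_def)
  have aa: "av y $ i = a i" for i by (simp add: a_def)
  have sym: "h j i = h i j" "h i l = h l i" "h j l = h l j"
    using hv_sym by (simp_all add: h_def)
  define HH where "HH = h l i * h j k + h l j * h i k + h l k * h i j"
  define HM where "HM = h l i * m j * m k + h l j * m i * m k + h l k * m i * m j
        + h i j * m l * m k + h i k * m l * m j + h j k * m l * m i"
  define MM where "MM = m l * m i * m j * m k"
  define X where "X i j k = r1 s * (h i j * m k + h i k * m j + h j k * m i) + r0' s * (m i * m j * m k)" for i j k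
  have C: "cartan F i j k y = X i j k / (2 * al y)" for i j k
    unfolding cartan_eq[OF yU] mm hh s_def[symmetric] X_def ..
  define S where "S i j l k = (r1 s * h i j + r0' s * m i * m j) * (r1 s * h l k + r0' s * m l * m k) * (m2 y / Q y)
     + 2 * r1 s * (r1 s * h i j + r0' s * m i * m j) * m l * m k * (1 / Q y)
     + 2 * r1 s * (r1 s * h l k + r0' s * m l * m k) * m i * m j * (1 / Q y)
     + r1 s * r1 s * ((h i l - (f0 s * f2 s / Q y) * m i * m l) * m j * m k
        + (h i k - (f0 s * f2 s / Q y) * m i * m k) * m j * m l
        + (h j l - (f0 s * f2 s / Q y) * m j * m l) * m i * m k
        + (h j k - (f0 s * f2 s / Q y) * m j * m k) * m i * m l) * (1 / r s)" for i j l k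
  have S: "(\<Sum>t\<in>UNIV. cartan F t i j y * cartan_up F t l k y) = S i j l k / (4 * al y * al y)" for i j l k
    unfolding cartan_sum[OF y] mm hh s_def[symmetric] S_def by simp
  have S3: "S i j l k + S j l i k + S i l j k = 
     r1 s * r1 s * (m2 y / Q y) * HH + (r1 s * r0' s * (m2 y / Q y) + 2 * r1 s * r1 s * (1 / Q y) + 2 * r1 s * r1 s * (1 / r s)) * HM
     + 3 * (r0' s * r0' s * (m2 y / Q y) + 4 * r1 s * r0' s * (1 / Q y) - 4 * r1 s * r1 s * (f0 s * f2 s / Q y) * (1 / r s)) * MM"
    unfolding S_def sym HH_def HM_def MM_def by (rule T_algebra_quadratic)
  define E where "E = - s * r0' s * m l * (h i j * m k + h i k * m j + h j k * m i)
     - r1 s * ((h l i * a j + h l j * a i) * m k + h i j * (m l * a k + s * h l k)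
       + (h l i * a k + h l k * a i) * m j + h i k * (m l * a j + s * h l j)
       + (h l j * a k + h l k * a j) * m i + h j k * (m l * a i + s * h l i))
     + r0'' s * (m l * m i * m j * m k)
     - r0' s * ((m l * a i + s * h l i) * m j * m k + (m l * a j + s * h l j) * m i * m k 
        + (m l * a k + s * h l k) * m i * m j)
     - (r1 s * (h i j * m k + h i k * m j + h j k * m i) + r0' s * (m i * m j * m k)) * a l"
  have E: "partial l (cartan F i j k) y = E / (2 * al y * al y)"
    unfolding partial_cartan[OF yU] mm hh aa s_def[symmetric] E_def ..
  have E': "f0 s * E + X l i j * (f0 s * a k + f1 s * m k) + X l i k * (f0 s * a j + f1 s * m j)
      + X l j k * (f0 s * a i + f1 s * m i) + X i j k * (f0 s * a l + f1 s * m l)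
     = - s * r1 s * f0 s * HH + (2 * r1 s * f1 s - s * r0' s * f0 s) * HM + (r0'' s * f0 s + 4 * r0' s * f1 s) * MM"
    unfolding E_def X_def sym HH_def HM_def MM_def by (rule T_algebra_linear)
  have "T_tensor F l i j k y = F y * (E / (2 * al y * al y)) - F y * ((S i j l k + S j l i k + S i l j k) / (4 * al y * al y))
     + (X l i j * (f0 s * a k + f1 s * m k) + X l i k * (f0 s * a j + f1 s * m j)
      + X l j k * (f0 s * a i + f1 s * m i) + X i j k * (f0 s * a l + f1 s * m l)) / (2 * al y)"
    unfolding T_tensor_def sum.distrib S unfolding C E partial_F[OF yU] mm aa s_def[symmetric]
    by (simp add: add_divide_distrib)
  also have "\<dots> = (f0 s * E + X l i j * (f0 s * a k + f1 s * m k) + X l i k * (f0 s * a j + f1 s * m j)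
      + X l j k * (f0 s * a i + f1 s * m i) + X i j k * (f0 s * a l + f1 s * m l)) / (2 * al y)
     - f0 s * (S i j l k + S j l i k + S i l j k) / (4 * al y)"
    unfolding F_eq s_def[symmetric] using nz(3) by (simp add: field_simps)
  \<comment> \<open>Both sides are combinations of \<open>HH\<close>, \<open>HM\<close> and
    \<open>MM\<close>, which leaves one scalar identity for each of the three coefficients.\<close>
  also have "\<dots> = PhiV y * HH + PsiV y * HM + OmegaV y * MM"
    unfolding E' S3 combine_coefficients
      Phi_eq[OF nz(3) nz(1) Q_def[of y, folded s_def] nz(2)]
      Psi_eq[OF nz(3) nz(1) Q_def[of y, folded s_def] nz(2)]
      Omega_eq[OF nz(3) nz(1) Q_def[of y, folded s_def] nz(2)] s_def[symmetric]
    using nz by (intro arg_cong2[where f = "(+)"] arg_cong2[where f = "(*)"] refl)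
      (simp_all add: field_simps)
  finally show ?thesis unfolding HH_def HM_def MM_def .
qed

end

section \<open>The equation $\sigma_h T^h_{ijk}=0$ in one tangent space\<close>

lemma inner_combination_zero:
  fixes X :: "real^'n::finite"
  assumes "\<And>k. A * X $ k + B * Y $ k + C * Z $ k + D * V $ k = 0"
  shows "A * (X \<bullet> t) + B * (Y \<bullet> t) + C * (Z \<bullet> t) + D * (V \<bullet> t) = 0"
proof -
  have "A *\<^sub>R X + B *\<^sub>R Y + C *\<^sub>R Z + D *\<^sub>R V = 0"
    using assms by (simp add: vec_eq_iff)
  then have "(A *\<^sub>R X + B *\<^sub>R Y + C *\<^sub>R Z + D *\<^sub>R V) \<bullet> t = 0" by simp
  then show ?thesis by (simp add: inner_add_left)
qed

context ab_fibre
begin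

definition Hm :: "real^'n \<Rightarrow> real^'n^'n" where "Hm y = (\<chi> i. hv y i)"

lemma Hm_nth: "(Hm y *v p) $ i = hv y i \<bullet> p"
  by (simp add: Hm_def matrix_vector_mul_component)

lemma Hm_sym: "p \<bullet> (Hm y *v q) = q \<bullet> (Hm y *v p)"
proof -
  have "transpose (Hm y) = Hm y" by (simp add: transpose_def vec_eq_iff Hm_def hv_sym)
  then show ?thesis by (metis dot_lmul_matrix inner_commute vector_transpose_matrix)
qed

lemma Hm_inner: "p \<bullet> (Hm y *v q) = p \<bullet> (G *v q) - (av y \<bullet> p) * (av y \<bullet> q)"
proof -
  have "Hm y *v q = G *v q - (av y \<bullet> q) *\<^sub>R av y"
    by (simp add: vec_eq_iff Hm_nth hv_inner)
  then show ?thesis by (simp add: inner_diff_right inner_commute)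
qed

definition contr :: "real^'n \<Rightarrow> real^'n \<Rightarrow> 'n \<Rightarrow> 'n \<Rightarrow> 'n \<Rightarrow> real" where
  "contr \<tau> y i j k = (\<Sum>h\<in>UNIV. \<tau> $ h * T_up F h i j k y)"

text \<open>The form \<open>v*\<close> matches the contraction over the first index of g^-1 in
  \<open>T_up\<close>; symmetry then enters through g instead of its inverse.\<close>

definition up :: "real^'n \<Rightarrow> real^'n \<Rightarrow> real^'n" where "up \<tau> y = \<tau> v* W y"

lemma fund_up:
  assumes y: "y \<in> D" shows "gm y *v up \<tau> y = \<tau>"
proof -
  have "invertible (gm y)" using y by (simp add: D_def ab_domain_def)
  then have "up \<tau> y v* gm y = \<tau>"
    by (simp add: up_def vector_matrix_mul_assoc fund_inv_def matrix_inv_invertible)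
  then show ?thesis
    by (metis fund_sym[OF D_U[OF y]] vector_transpose_matrix)
qed

lemma contr_eq:
  fixes \<tau> y :: "real^'n"
  assumes y: "y \<in> D"
  defines "v \<equiv> up \<tau> y"
  shows "contr \<tau> y i j k =
       PhiV y * ((Hm y *v v) $ i * hv y j $ k + (Hm y *v v) $ j * hv y i $ k + (Hm y *v v) $ k * hv y i $ j)
       + PsiV y * ((Hm y *v v) $ i * mv y $ j * mv y $ k + (Hm y *v v) $ j * mv y $ i * mv y $ k
           + (Hm y *v v) $ k * mv y $ i * mv y $ j
           + (mv y \<bullet> v) * (hv y i $ j * mv y $ k + hv y i $ k * mv y $ j + hv y j $ k * mv y $ i))
       + OmegaV y * (mv y \<bullet> v) * (mv y $ i * mv y $ j * mv y $ k)"
proof -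
  have V: "(Hm y *v v) $ i = (\<Sum>l\<in>UNIV. v $ l * hv y l $ i)" for i
    by (simp add: Hm_nth inner_vec_def hv_sym[of y i] mult.commute)
  have M: "mv y \<bullet> v = (\<Sum>l\<in>UNIV. v $ l * mv y $ l)"
    by (simp add: inner_vec_def mult.commute)
  have "contr \<tau> y i j k = (\<Sum>h\<in>UNIV. \<Sum>l\<in>UNIV. \<tau> $ h * (W y $ h $ l * T_tensor F l i j k y))"
    by (simp add: contr_def T_up_def sum_distrib_left)
  also have "\<dots> = (\<Sum>l\<in>UNIV. \<Sum>h\<in>UNIV. \<tau> $ h * (W y $ h $ l * T_tensor F l i j k y))"
    by (rule sum.swap)
  also have "\<dots> = (\<Sum>l\<in>UNIV. v $ l * T_tensor F l i j k y)"
    by (simp add: v_def up_def vector_matrix_mult_def sum_distrib_right sum_distrib_left mult_ac)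
  also have "\<dots> = PhiV y * ((Hm y *v v) $ i * hv y j $ k + (Hm y *v v) $ j * hv y i $ k + (Hm y *v v) $ k * hv y i $ j)
       + PsiV y * ((Hm y *v v) $ i * mv y $ j * mv y $ k + (Hm y *v v) $ j * mv y $ i * mv y $ k
           + (Hm y *v v) $ k * mv y $ i * mv y $ j
           + (mv y \<bullet> v) * (hv y i $ j * mv y $ k + hv y i $ k * mv y $ j + hv y j $ k * mv y $ i))
       + OmegaV y * (mv y \<bullet> v) * (mv y $ i * mv y $ j * mv y $ k)"
    unfolding V M T_tensor_eq[OF y] sum_distrib_left sum_distrib_right sum.distrib[symmetric]
    by (rule sum.cong[OF refl]) algebra
  finally show ?thesis .
qed

text \<open>Contracting k, j and i in turn with t, z and x frees the equation from coordinates, so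
  that it can be tested on vectors adapted to y and m. Each time the equation is sorted as a
  combination of four covectors in the index to be contracted.\<close>

lemma contr_trilinear:
  fixes v y :: "real^'n"
  defines "V \<equiv> Hm y *v v" and "M \<equiv> mv y \<bullet> v" and "m \<equiv> mv y" and "H \<equiv> \<lambda>x. Hm y *v x"
  assumes E: "\<And>i j k. 
       P * (V $ i * hv y j $ k + V $ j * hv y i $ k + V $ k * hv y i $ j)
       + S * (V $ i * mv y $ j * mv y $ k + V $ j * mv y $ i * mv y $ k
           + V $ k * mv y $ i * mv y $ j
           + M * (hv y i $ j * mv y $ k + hv y i $ k * mv y $ j + hv y j $ k * mv y $ i))
       + Om * M * (mv y $ i * mv y $ j * mv y $ k) = 0"
  shows "P * ((V \<bullet> x) * (z \<bullet> H t) + (V \<bullet> z) * (x \<bullet> H t) + (V \<bullet> t) * (x \<bullet> H z))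
    + S * ((V \<bullet> x) * (m \<bullet> z) * (m \<bullet> t) + (V \<bullet> z) * (m \<bullet> x) * (m \<bullet> t) + (V \<bullet> t) * (m \<bullet> x) * (m \<bullet> z)
      + M * ((x \<bullet> H z) * (m \<bullet> t) + (x \<bullet> H t) * (m \<bullet> z) + (z \<bullet> H t) * (m \<bullet> x)))
    + Om * M * ((m \<bullet> x) * (m \<bullet> z) * (m \<bullet> t)) = 0"
proof -
  have H: "hv y i \<bullet> t = H t $ i" for i t by (simp add: H_def Hm_nth)
  have "(P * V $ i + S * M * m $ i) * hv y j $ k + (P * V $ j + S * M * m $ j) * hv y i $ k
      + (P * hv y i $ j + S * m $ i * m $ j) * V $ k
      + (S * (V $ i * m $ j + V $ j * m $ i + M * hv y i $ j) + Om * M * m $ i * m $ j) * m $ k = 0" for i j k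
    using E[of i j k] unfolding m_def by algebra
  note 1 = inner_combination_zero[OF this, of _ _ t, unfolded H]
  have "(P * V $ i + S * M * m $ i) * H t $ j
      + (P * H t $ i + S * (m \<bullet> t) * m $ i) * V $ j
      + (P * (V \<bullet> t) + S * M * (m \<bullet> t)) * hv y i $ j
      + (S * M * H t $ i + S * m $ i * (V \<bullet> t) + S * V $ i * (m \<bullet> t) + Om * M * m $ i * (m \<bullet> t)) * m $ j = 0"
    for i j using 1[of i j] by algebra
  note 2 = inner_combination_zero[OF this, of _ z, unfolded H]
  have "(P * (H t \<bullet> z) + S * (m \<bullet> t) * (m \<bullet> z)) * V $ i
      + (P * (V \<bullet> z) + S * M * (m \<bullet> z)) * H t $ i
      + (P * (V \<bullet> t) + S * M * (m \<bullet> t)) * H z $ i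
      + (S * M * (H t \<bullet> z) + S * (m \<bullet> t) * (V \<bullet> z) + S * (V \<bullet> t) * (m \<bullet> z)
         + Om * M * (m \<bullet> t) * (m \<bullet> z)) * m $ i = 0" for i
    using 2[of i] by algebra
  note 3 = inner_combination_zero[OF this, of x]
  show ?thesis
    using 3 unfolding inner_commute[of z "H t"] inner_commute[of x "H t"] inner_commute[of x "H z"] by algebra
qed

text \<open>The pairing \<tau>_i b^i; what matters is that it is constant in y.\<close>

definition kap :: "real^'n \<Rightarrow> real" where "kap \<tau> = \<tau> \<bullet> (matrix_inv G *v w)"

text \<open>Chosen so that \<open>pm y\<close> is b raised by a, minus \<open>tau y / F y\<close>
  times y.\<close>

definition tau :: "real^'n \<Rightarrow> real" where
  "tau y = sv y * f0 (sv y) + f1 (sv y) * m2 y"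

text \<open>Up to the factor \<open>Q\<close>, the equation on the right says that \<open>m\<^sub>r g\<^sup>r\<^sup>s \<tau>\<^sub>s = 0\<close>.\<close>
definition annih :: "real^'n \<Rightarrow> real^'n \<Rightarrow> bool" where
  "annih \<tau> y \<longleftrightarrow> kap \<tau> * (al y * f0 (sv y)) = tau y * (\<tau> \<bullet> y)"

text \<open>Pairing g v = \<tau> with \<open>pm\<close> gives Q m(v) = \<tau>(\<open>pm\<close>) by
  symmetry and \<open>fund_pm\<close>, and g^-1 has disappeared.\<close>

lemma annih_iff:
  assumes y: "y \<in> D" and v: "gm y *v v = \<tau>"
  shows "annih \<tau> y \<longleftrightarrow> mv y \<bullet> v = 0"
proof -
  note yU = D_U[OF y]
  have nz: "Q y \<noteq> 0" "al y > 0" "f0 (sv y) > 0" using y al_pos phi_pos by (auto simp: D_iff)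
  have "Q y * (mv y \<bullet> v) = pm y \<bullet> \<tau>"
    using fund_inner_sym[OF yU, of "pm y" v] v fund_pm[OF yU] by (simp add: inner_commute)
  also have "\<dots> = kap \<tau> - (sv y / al y) * (\<tau> \<bullet> y) - f1 (sv y) * m2 y / F y * (\<tau> \<bullet> y)"
    unfolding inner_commute[of "pm y"] by (simp add: pm_def Nv_def inner_diff_right kap_def)
  also have "\<dots> = (kap \<tau> * (al y * f0 (sv y)) - tau y * (\<tau> \<bullet> y)) / (al y * f0 (sv y))"
    using nz by (simp add: F_eq tau_def field_simps)
  finally show ?thesis using nz by (auto simp: annih_def)
qed

text \<open>The first part leads to (a) and (b), the second to \<tau> being a multiple of b. The
  alternative \<open>annih\<close> cannot be excluded at one y; that is done later on open
  sets.\<close>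

lemma contr_zero_cases:
  assumes y: "y \<in> D" and m2: "m2 y \<noteq> 0" and z: "\<And>i j k. contr \<tau> y i j k = 0"
  shows "annih \<tau> y \<or> (PhiV y + m2 y * PsiV y = 0 \<and> m2 y * OmegaV y + 3 * PsiV y = 0)"
    and "(PhiV y = 0 \<and> PsiV y = 0 \<and> OmegaV y = 0) \<or> annih \<tau> y \<or> \<tau> \<in> span {w, G *v y}"
proof -
  note yU = D_U[OF y]
  have y0: "y \<noteq> 0" using y by (simp add: D_iff)
  define v where "v = up \<tau> y"
  note v = fund_up[OF y, of \<tau>, folded v_def]
  note c = contr_eq[OF y, of \<tau>, folded v_def]
  note E = contr_trilinear[of "PhiV y" y v "PsiV y" "OmegaV y", OF trans[OF c[symmetric] z]]
  define M where "M = mv y \<bullet> v"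
  define H where "H = (\<lambda>x. Hm y *v x)"
  define N where "N = Nv y"
  have Hy: "H y = 0" using y0 by (simp add: H_def vec_eq_iff Hm_nth hv_y)
  have HN: "H N = mv y" using y0 by (simp add: H_def N_def vec_eq_iff Hm_nth hv_Nv)
  \<comment> \<open>\<open>u\<close> is the component of \<open>v\<close> orthogonal to \<open>y\<close> and to \<open>m\<close>; the equation is tested on
    \<open>(u, u, u)\<close>, \<open>(u, N, N)\<close>, \<open>(N, N, N)\<close> and, if \<open>u = 0\<close>, on \<open>(e, e, N)\<close> with \<open>e\<close> orthogonal to \<open>y\<close> and \<open>m\<close>.\<close>
  define u where "u = v - (av y \<bullet> v / al y) *\<^sub>R y - (M / m2 y) *\<^sub>R N"
  have mN: "mv y \<bullet> N = m2 y" using y0 by (simp add: N_def mv_Nv)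
  have mu: "mv y \<bullet> u = 0"
    using y0 m2 by (simp add: u_def inner_diff_right mv_y mN M_def)
  have au: "av y \<bullet> u = 0"
    using y0 al_pos[OF y0] by (simp add: u_def inner_diff_right av_y N_def av_Nv)
  have Hu: "H u = H v - (M / m2 y) *\<^sub>R mv y"
    using Hy HN by (simp add: u_def H_def matrix_vector_mult_diff_distrib matrix_vector_mult_scaleR)
  define q where "q = u \<bullet> H u"
  have q: "q = u \<bullet> (G *v u)" by (simp add: q_def H_def Hm_inner au)
  have Vu: "H v \<bullet> u = q" using Hu mu by (simp add: q_def inner_diff_right inner_commute[of _ u] inner_commute[of "mv y" u])
  have VN: "H v \<bullet> N = M" using HN Hm_sym[of N y v] by (simp add: H_def M_def inner_commute)
  have uN: "u \<bullet> H N = 0" "N \<bullet> H u = 0" using HN mu Hm_sym[of N y u] by (simp_all add: H_def inner_commute)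
  have NN: "N \<bullet> H N = m2 y" using HN mN by (simp add: inner_commute)
  note E = E[folded M_def, folded H_def]
  have 1: "PhiV y * q * q = 0"
    using E[of u u u] mu Vu by (simp add: q_def[symmetric])
  have 2: "q * m2 y * (PhiV y + m2 y * PsiV y) = 0"
    using E[of u N N] mu Vu VN uN NN mN by (simp add: algebra_simps)
  have 3: "M * m2 y * (3 * (PhiV y + m2 y * PsiV y) + m2 y * (m2 y * OmegaV y + 3 * PsiV y)) = 0"
    using E[of N N N] VN NN mN by (simp add: algebra_simps)
  have A: "annih \<tau> y \<longleftrightarrow> M = 0" unfolding M_def by (rule annih_iff[OF y v])
  have *: "(annih \<tau> y \<or> (PhiV y + m2 y * PsiV y = 0 \<and> m2 y * OmegaV y + 3 * PsiV y = 0)) \<and>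
    ((PhiV y = 0 \<and> PsiV y = 0 \<and> OmegaV y = 0) \<or> annih \<tau> y \<or> \<tau> \<in> span {w, G *v y})"
  proof (cases "u = 0")
    case False
    then have "q > 0" by (simp add: q G_pos)
    \<comment> \<open>Phi = 0 comes from (u, u, u), then Psi = 0 from (u, N, N); after that (N, N,
      N) leaves M = 0 or Omega = 0.\<close>
    then have "PhiV y = 0" "PsiV y = 0" using 1 2 m2 by auto
    then show ?thesis using 3 m2 A by auto
  next
    case True
    then have V: "H v = (M / m2 y) *\<^sub>R mv y" using Hu by (simp add: H_def)
    \<comment> \<open>Since h v is a multiple of m, lowering v by g produces only m and
      \<open>av\<close>.\<close>
    have "\<tau> $ i = (r (sv y) * (M / m2 y) + r0 (sv y) * M + f0 (sv y) * f1 (sv y) * (av y \<bullet> v)) * mv y $ i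
        + (f0 (sv y) * f1 (sv y) * M + f0 (sv y) * f0 (sv y) * (av y \<bullet> v)) * av y $ i" for i
    proof -
      have "hv y i \<bullet> v = (M / m2 y) * mv y $ i"
        using arg_cong[OF V, of "\<lambda>x. x $ i"] by (simp add: H_def Hm_nth)
      then show ?thesis
        unfolding v[symmetric] fund_mult[OF yU] M_def[symmetric] by (simp add: algebra_simps)
    qed
    then have "\<tau> = (r (sv y) * (M / m2 y) + r0 (sv y) * M + f0 (sv y) * f1 (sv y) * (av y \<bullet> v)) *\<^sub>R mv y
        + (f0 (sv y) * f1 (sv y) * M + f0 (sv y) * f0 (sv y) * (av y \<bullet> v)) *\<^sub>R av y"
      by (simp add: vec_eq_iff)
    then have "\<tau> \<in> span {mv y, av y}"
      by (auto intro!: span_add span_scale intro: span_base)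
    moreover have "av y \<in> span {w, G *v y}" "mv y \<in> span {w, G *v y}"
      unfolding mv_def av_def by (auto intro!: span_scale span_diff intro: span_base)
    ultimately have sp: "\<tau> \<in> span {w, G *v y}"
      using span_minimal[of "{mv y, av y}" "span {w, G *v y}"] by auto
    obtain e where e: "e \<noteq> 0" "mv y \<bullet> e = 0" "av y \<bullet> e = 0"
      using exists_orthogonal_pair[OF card3] by blast
    have ee: "e \<bullet> H e > 0" using e G_pos by (simp add: H_def Hm_inner)
    have eN: "e \<bullet> H N = 0" using HN e by (simp add: inner_commute)
    have Ve: "H v \<bullet> e = 0" using V e by simp
    have "M * (e \<bullet> H e) * (PhiV y + m2 y * PsiV y) = 0"
      using E[of e e N] e Ve VN eN mN by (simp add: algebra_simps)
    then have "M = 0 \<or> PhiV y + m2 y * PsiV y = 0" using ee by auto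
    \<comment> \<open>The value on (N, N, N) mixes (a) and (b), so it yields (b) only after (a) is
      known.\<close>
    moreover have "M = 0 \<or> m2 y * OmegaV y + 3 * PsiV y = 0" if "PhiV y + m2 y * PsiV y = 0"
      using 3 m2 unfolding that by simp
    ultimately have "M = 0 \<or> (PhiV y + m2 y * PsiV y = 0 \<and> m2 y * OmegaV y + 3 * PsiV y = 0)" by auto
    then show ?thesis using A sp by auto
  qed
  then show "annih \<tau> y \<or> (PhiV y + m2 y * PsiV y = 0 \<and> m2 y * OmegaV y + 3 * PsiV y = 0)"
    and "(PhiV y = 0 \<and> PsiV y = 0 \<and> OmegaV y = 0) \<or> annih \<tau> y \<or> \<tau> \<in> span {w, G *v y}"
    by auto
qed

lemma contr_zero_parallel:
  assumes y: "y \<in> D" and t: "\<tau> = t *\<^sub>R w"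
    and a: "PhiV y + m2 y * PsiV y = 0" and b: "m2 y * OmegaV y + 3 * PsiV y = 0"
  shows "contr \<tau> y i j k = 0"
proof -
  note yU = D_U[OF y]
  have y0: "y \<noteq> 0" using y by (simp add: D_iff)
  have nz: "Q y \<noteq> 0" "al y > 0" "f0 (sv y) > 0" "F y > 0" using y al_pos phi_pos F_pos[OF yU] by (auto simp: D_iff)
  define v where "v = up \<tau> y"
  note v = fund_up[OF y, of \<tau>, folded v_def]
  note c = contr_eq[OF y, of \<tau>, folded v_def]
  \<comment> \<open>From b = m + s \<open>av\<close> and g y = F (\<phi> \<open>av\<close> + \<phi>'
    m) one gets b = (1 - s\<phi>'/\<phi>) m + s/(F\<phi>) g y, and g^-1 m =
    \<open>pm\<close>/Q.\<close>
  define c1 where "c1 = t * (1 - sv y * f1 (sv y) / f0 (sv y)) / Q y"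
  have "gm y *v (c1 *\<^sub>R pm y + (t * sv y / (F y * f0 (sv y))) *\<^sub>R y) = \<tau>"
    using nz unfolding t
    by (simp add: matrix_vector_right_distrib matrix_vector_mult_scaleR fund_pm[OF yU] fund_y[OF yU] c1_def
       vec_eq_iff mv_def field_simps)
  then have v': "v = c1 *\<^sub>R pm y + (t * sv y / (F y * f0 (sv y))) *\<^sub>R y"
    using v W_fund(1)[OF y] by metis
  have M: "mv y \<bullet> v = c1 * m2 y"
    using y0 by (simp add: v' inner_add_right pm_inner[OF yU] mv_y)
  have V: "(Hm y *v v) $ i = c1 * mv y $ i" for i
    using y0 by (simp add: Hm_nth v' inner_add_right pm_inner[OF yU] hv_y)
  have "contr \<tau> y i j k = c1 * ((PhiV y + m2 y * PsiV y) *
     (mv y $ i * hv y j $ k + mv y $ j * hv y i $ k + mv y $ k * hv y i $ j)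
     + (m2 y * OmegaV y + 3 * PsiV y) * (mv y $ i * mv y $ j * mv y $ k))"
    unfolding c M V by algebra
  then show ?thesis by (simp add: a b)
qed

text \<open>At a zero of b one has s = m = 0, \<rho> = Q = \<phi>^2 and \<rho>1 = \<phi>\<phi>', so
  the two remaining terms \<phi>\<phi>'^2/\<alpha> of Psi cancel. Such points are excluded from the
  density arguments in y.\<close>

lemma w_zero:
  assumes w: "w = 0" and y: "y \<in> D"
  shows "PhiV y = 0" "PsiV y = 0" "m2 y = 0" "T_tensor F l i j k y = 0"
proof -
  have s: "sv y = 0" "m2 y = 0" "mv y = 0"
    unfolding m2_def mv_def by (simp_all add: w sval_def beta_def bsq_def)
  have nz: "r (sv y) \<noteq> 0" "Q y \<noteq> 0" "al y \<noteq> 0" "f0 (sv y) > 0" using y al_pos[of y] phi_pos by (auto simp: D_iff)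
  show P: "PhiV y = 0" by (simp add: Phi_def s)
  show "PsiV y = 0" using nz(1,3,4)
    unfolding Psi_eq[OF nz(3) nz(1) Q_def nz(2)] 
    by (simp add: s Q_def rho_def rho1_def field_simps power2_eq_square)
  show "m2 y = 0" by (rule s)
  show "T_tensor F l i j k y = 0" unfolding T_tensor_eq[OF y] by (simp add: P[unfolded s] s)
qed

end

section \<open>Open sets of tangent vectors and continuity\<close>

context ab_fibre
begin

lemma inv_mult_G: "matrix_inv G *v (G *v x) = x"
  by (metis inv_G matrix_inv_invertible(2) matrix_vector_mul_assoc matrix_vector_mul_lid)

text \<open>The preimage of the span under \<open>G\<close> is a closed subspace of dimension at
  most 2 < n, hence without interior.\<close>

lemma open_avoids_span:
  assumes "open N" "N \<noteq> {}"
  obtains N' where "open N'" "N' \<noteq> {}" "N' \<subseteq> N" "\<And>y. y \<in> N' \<Longrightarrow> G *v y \<notin> span {x, z}"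
proof -
  define S where "S = span {matrix_inv G *v x, matrix_inv G *v z}"
  have "dim S \<le> card {matrix_inv G *v x, matrix_inv G *v z}" by (simp add: S_def dim_le_card')
  also have "\<dots> \<le> 2" by (simp add: card_insert_if)
  finally have "dim S < DIM(real^'n)" using card3 by simp
  then have int: "interior S = {}" by (rule empty_interior_lowdim)
  have cl: "closed S" by (simp add: S_def closed_subspace)
  have in_S: "y \<in> S" if "G *v y \<in> span {x, z}" for y
  proof -
    have "matrix_inv G *v (G *v y) \<in> (*v) (matrix_inv G) ` span {x, z}" using that by blast
    also have "\<dots> = S" by (simp add: S_def linear_span_image[symmetric] linear_linear)
    finally show ?thesis by (simp add: inv_mult_G)
  qed
  have "\<not> N \<subseteq> S" using interior_maximal[of N S] assms int by auto
  then show ?thesis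
    using in_S assms cl by (intro that[of "N - S"]) (auto intro: open_Diff)
qed

text \<open>By exchange, if \<tau> lies in the span of w and G y but not in that of w, then G y lies
  in the span of \<tau> and w, which does not depend on y and can be avoided.\<close>

lemma open_avoids_combination:
  assumes "open N" "N \<noteq> {}" "\<tau> \<notin> span {w}"
  obtains N' where "open N'" "N' \<noteq> {}" "N' \<subseteq> N" "\<And>y. y \<in> N' \<Longrightarrow> \<tau> \<notin> span {w, G *v y}"
proof -
  obtain N' where N': "open N'" "N' \<noteq> {}" "N' \<subseteq> N" "\<And>y. y \<in> N' \<Longrightarrow> G *v y \<notin> span {\<tau>, w}"
    by (rule open_avoids_span[OF assms(1,2), of \<tau> w]) blast
  have "\<tau> \<notin> span {w, G *v y}" if "y \<in> N'" for y
    using N'(4)[OF that] assms(3) in_span_insert[of \<tau> "G *v y" "{w}"] by (auto simp: insert_commute)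
  then show ?thesis using that N' by blast
qed

lemma has_partial_tau:
  assumes y: "y \<in> U"
  shows "has_partial i tau (Q y / f0 (sv y) * (mv y $ i / al y)) y"
proof -
  have y0: "y \<noteq> 0" "sv y \<in> I" using U_D[OF y] by auto
  have eq: "tau = (\<lambda>z. (\<lambda>t. t * f0 t + f1 t * (bsq G w - t\<^sup>2)) (sv z))"
    by (simp add: fun_eq_iff tau_def m2_def)
  have "((\<lambda>t. t * f0 t + f1 t * (bsq G w - t\<^sup>2)) has_real_derivative Q y / f0 (sv y)) (at (sv y))"
    using has_deriv_phi[OF y0(2)] phi_pos[OF y0(2)]
    by (auto intro!: derivative_eq_intros simp: Q_def m2_def rho_def field_simps power2_eq_square)
  then show ?thesis unfolding eq by (rule has_partial_compose) (rule has_partial_sv[OF y0(1)])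
qed

text \<open>Differentiating \<open>annih\<close> in \<open>y\<close> puts \<open>\<tau>\<close> into the span of \<open>b\<close> and \<open>y\<close> (lowered by \<open>a\<close>) for an open set
  of \<open>y\<close>, which in dimension at least 3 leaves only multiples of \<open>b\<close>.\<close>
lemma annih_open:
  assumes N: "open N" "N \<noteq> {}" "N \<subseteq> D" "\<And>y. y \<in> N \<Longrightarrow> m2 y \<noteq> 0"
    and an: "\<And>y. y \<in> N \<Longrightarrow> annih \<tau> y"
  shows "\<tau> = 0"
proof -
  have grad: "kap \<tau> * (f0 (sv y) * av y $ i + f1 (sv y) * mv y $ i)
      = Q y / f0 (sv y) * (mv y $ i / al y) * (\<tau> \<bullet> y) + \<tau> $ i * tau y" if y: "y \<in> N" for y i
  proof -
    have yU: "y \<in> U" using y N(3) D_U by auto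
    have y0: "y \<noteq> 0" "sv y \<in> I" using U_D[OF yU] by auto
    have "has_partial i (\<lambda>z. kap \<tau> * (al z * f0 (sv z)) - tau z * (\<tau> \<bullet> z))
       (kap \<tau> * (f0 (sv y) * av y $ i + f1 (sv y) * mv y $ i)
         - (Q y / f0 (sv y) * (mv y $ i / al y) * (\<tau> \<bullet> y) + \<tau> $ i * tau y)) y"
      using al_pos[OF y0(1)]
      by (intro has_partial_eq[OF has_partial_diff[OF has_partial_mult[OF has_partial_const
          has_partial_mult[OF has_partial_al[OF y0(1)] has_partial_compose[OF has_deriv_phi(1)[OF y0(2)] has_partial_sv[OF y0(1)]]]]
          has_partial_mult[OF has_partial_tau[OF yU] has_partial_inner]]])
        (simp add: field_simps)
    moreover have "has_partial i (\<lambda>z. kap \<tau> * (al z * f0 (sv z)) - tau z * (\<tau> \<bullet> z)) 0 y"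
      by (rule has_partial_transform[OF N(1) y _ has_partial_const[of i 0]]) (use an in \<open>simp add: annih_def\<close>)
    ultimately show ?thesis using has_partial_unique by force
  qed
  have pos: "al y > 0" "f0 (sv y) > 0" "Q y \<noteq> 0" "r (sv y) \<noteq> 0" "y \<noteq> 0" if "y \<in> N" for y
    using that N(3) al_pos phi_pos by (auto simp: D_iff)
  show ?thesis
  proof (cases "kap \<tau> = 0")
    case True
    \<comment> \<open>Here \<open>tau y\<close> times \<tau>(y) is zero. Where \<tau>(y) is nonzero,
      \<open>tau y\<close> = 0 and the differentiated identity forces m = 0, against m^2 \<noteq>
      0.\<close>
    have zero: "\<tau> \<bullet> y = 0" if y: "y \<in> N" for y
    proof (rule ccontr)
      assume nz: "\<tau> \<bullet> y \<noteq> 0"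
      then have t0: "tau y = 0" using an[OF y] True by (simp add: annih_def)
      have "mv y = 0" using grad[OF y] nz t0 True pos[OF y] by (simp add: vec_eq_iff)
      then show False using mv_Nv[of y] pos[OF y] N(4)[OF y] by simp
    qed
    obtain y where y: "y \<in> N" using N(2) by auto
    have "\<tau> $ i = 0" for i
    proof -
      have "has_partial i (\<lambda>z. \<tau> \<bullet> z) 0 y"
        by (rule has_partial_transform[OF N(1) y _ has_partial_const[of i 0]]) (use zero in simp)
      with has_partial_inner[of i \<tau> y] show ?thesis by (rule has_partial_unique)
    qed
    then show ?thesis by (simp add: vec_eq_iff)
  next
    case False
    have "\<tau> \<in> span {w, G *v y}" if y: "y \<in> N" for y
    proof -
      have t: "tau y \<noteq> 0" using an[OF y] False pos[OF y] by (auto simp: annih_def)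
      define c1 c2 where "c1 = (kap \<tau> * f1 (sv y) - Q y / f0 (sv y) / al y * (\<tau> \<bullet> y)) / tau y"
        and "c2 = kap \<tau> * f0 (sv y) / tau y"
      have "\<tau> $ i = c1 * mv y $ i + c2 * av y $ i" for i
        using grad[OF y, of i] t by (simp add: c1_def c2_def field_simps)
      then have "\<tau> = c1 *\<^sub>R mv y + c2 *\<^sub>R av y" by (simp add: vec_eq_iff)
      moreover have "av y \<in> span {w, G *v y}" "mv y \<in> span {w, G *v y}"
        unfolding mv_def av_def by (auto intro!: span_scale span_diff intro: span_base)
      ultimately show ?thesis by (auto intro: span_add span_scale)
    qed
    then have "\<tau> \<in> span {w}" using open_avoids_combination[OF N(1,2), of \<tau> False] by blast
    then obtain t where t: "\<tau> = t *\<^sub>R w" by (auto simp: span_singleton)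
    obtain y where y: "y \<in> N" using N(2) by auto
    \<comment> \<open>For \<tau> = t b the identity becomes t m^2 (\<phi> - s\<phi>') = 0, and
      \<phi> (\<phi> - s\<phi>') is \<rho>, which is nonzero on \<open>D\<close>.\<close>
    have "t * bsq G w * (al y * f0 (sv y)) = tau y * t * (sv y * al y)"
      using an[OF y] w_y[OF pos(5)[OF y]] by (simp add: annih_def t kap_def bsq_eq)
    then have "t * (bsq G w * f0 (sv y) - tau y * sv y) = 0" using pos(1)[OF y] by (simp add: algebra_simps)
    also have "bsq G w * f0 (sv y) - tau y * sv y = m2 y * (f0 (sv y) - sv y * f1 (sv y))"
      by (simp add: tau_def m2_def algebra_simps power2_eq_square)
    finally have "t = 0 \<or> f0 (sv y) - sv y * f1 (sv y) = 0" using N(4)[OF y] by simp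
    moreover have "r (sv y) = f0 (sv y) * (f0 (sv y) - sv y * f1 (sv y))"
      by (simp add: rho_def algebra_simps power2_eq_square)
    ultimately show ?thesis using pos(4)[OF y] t by auto
  qed
qed

lemma bsq_pos: "w \<noteq> 0 \<Longrightarrow> bsq G w > 0"
  using G_pos[of "matrix_inv G *v w"] G_mult_inv[of w] by (fastforce simp: bsq_eq inner_commute)

text \<open>m^2 is the squared norm of m with respect to a; this is the equality case of
  Cauchy-Schwarz.\<close>

lemma m2_zero_imp:
  assumes "y \<noteq> 0" "m2 y = 0" shows "mv y = 0"
proof -
  have "Nv y \<bullet> (G *v Nv y) = 0" using assms by (simp add: G_Nv mv_Nv inner_commute[of "Nv y"])
  then have "Nv y = 0" using G_pos by fastforce
  then show ?thesis using G_Nv[OF assms(1)] by simp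
qed

lemma m2_nonzero_dense:
  assumes "w \<noteq> 0" "open N" "N \<noteq> {}" "N \<subseteq> D"
  obtains y where "y \<in> N" "m2 y \<noteq> 0"
proof -
  \<comment> \<open>Repeating \<open>w\<close> reduces the two-vector statement to multiples of b; m
    = 0 would make the lowered y such a multiple.\<close>
  obtain N' where N': "open N'" "N' \<noteq> {}" "N' \<subseteq> N" "\<And>y. y \<in> N' \<Longrightarrow> G *v y \<notin> span {w, w}"
    by (rule open_avoids_span[OF assms(2,3), of w w]) blast
  then obtain y where y: "y \<in> N'" by auto
  have "m2 y \<noteq> 0"
  proof
    assume m: "m2 y = 0"
    have y0: "y \<noteq> 0" using y N' assms(4) by (auto simp: D_iff)
    have s: "sv y \<noteq> 0" using m bsq_pos[OF assms(1)] by (auto simp: m2_def)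
    have "w = (sv y / al y) *\<^sub>R (G *v y)" using m2_zero_imp[OF y0 m] by (simp add: mv_def av_def)
    then have "(al y / sv y) *\<^sub>R w = (al y / sv y) *\<^sub>R ((sv y / al y) *\<^sub>R (G *v y))" by (rule arg_cong)
    also have "\<dots> = G *v y" using s al_pos[OF y0] by simp
    finally show False using N'(4)[OF y] by (metis span_base insertI1 span_scale)
  qed
  then show ?thesis using y N' that by blast
qed

text \<open>The filter is arbitrary and \<open>a\<close>, \<open>s\<close>, \<open>m\<close> are
  independent, because the limits are taken both in y within a fibre and in x for fixed y. The last
  conclusion makes the domain open in either variable.\<close>

lemma tendsto_quantities:
  assumes a: "(a \<longlongrightarrow> a0) Fl" "a0 \<noteq> 0" and s: "(s \<longlongrightarrow> s0) Fl" "s0 \<in> I" and m: "(m \<longlongrightarrow> m0) Fl"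
    and nz: "r s0 \<noteq> 0" "r s0 + m0 * f0 s0 * f2 s0 \<noteq> 0"
  shows "((\<lambda>x. Phi \<phi> (m x) (a x) (s x)) \<longlongrightarrow> Phi \<phi> m0 a0 s0) Fl"
    "((\<lambda>x. Psi \<phi> (m x) (a x) (s x)) \<longlongrightarrow> Psi \<phi> m0 a0 s0) Fl"
    "((\<lambda>x. Omega \<phi> (m x) (a x) (s x)) \<longlongrightarrow> Omega \<phi> m0 a0 s0) Fl"
    "eventually (\<lambda>x. a x \<noteq> 0 \<and> s x \<in> I \<and> r (s x) \<noteq> 0 \<and> r (s x) + m x * f0 (s x) * f2 (s x) \<noteq> 0) Fl"
proof -
  have c: "((\<lambda>x. g (s x)) \<longlongrightarrow> g s0) Fl" if "isCont g s0" for g :: "real \<Rightarrow> real"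
    using that s(1) by (rule isCont_tendsto_compose)
  note c = c[OF DERIV_isCont]
  note cs = c[OF has_deriv_phi(1)[OF s(2)]] c[OF has_deriv_phi(2)[OF s(2)]] c[OF has_deriv_phi(3)[OF s(2)]]
    c[OF has_deriv_r[OF s(2)]] c[OF has_deriv_r1[OF s(2)]] c[OF has_deriv_r0'[OF s(2)]]
    isCont_tendsto_compose[OF isCont_r0''[OF s(2)] s(1)]
  have K1: "((\<lambda>x. K1 \<phi> (m x) (a x) (s x)) \<longlongrightarrow> K1 \<phi> m0 a0 s0) Fl"
    unfolding K1_def using a(2) nz by (intro tendsto_intros cs a(1) s(1) m) auto
  have K2: "((\<lambda>x. K2 \<phi> (m x) (a x) (s x)) \<longlongrightarrow> K2 \<phi> m0 a0 s0) Fl"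
    unfolding K2_def using a(2) nz by (intro tendsto_intros cs a(1) s(1) m) auto
  show "((\<lambda>x. Phi \<phi> (m x) (a x) (s x)) \<longlongrightarrow> Phi \<phi> m0 a0 s0) Fl"
    unfolding Phi_def using a(2) nz by (intro tendsto_intros cs a(1) s(1) m K1) auto
  show "((\<lambda>x. Psi \<phi> (m x) (a x) (s x)) \<longlongrightarrow> Psi \<phi> m0 a0 s0) Fl"
    unfolding Psi_def using a(2) nz by (intro tendsto_intros cs a(1) s(1) m K2) auto
  show "((\<lambda>x. Omega \<phi> (m x) (a x) (s x)) \<longlongrightarrow> Omega \<phi> m0 a0 s0) Fl"
    unfolding Omega_def using a(2) nz by (intro tendsto_intros cs a(1) s(1) m K2) auto
  have "eventually (\<lambda>x. a x \<noteq> 0) Fl" by (rule tendsto_imp_eventually_ne[OF a])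
  moreover have "eventually (\<lambda>x. s x \<in> I) Fl" using topological_tendstoD[OF s(1) open_I s(2)] .
  moreover have "eventually (\<lambda>x. r (s x) \<noteq> 0) Fl"
    by (rule tendsto_imp_eventually_ne[OF cs(4) nz(1)])
  moreover have "eventually (\<lambda>x. r (s x) + m x * f0 (s x) * f2 (s x) \<noteq> 0) Fl"
    by (rule tendsto_imp_eventually_ne[OF _ nz(2)]) (intro tendsto_intros cs m)
  ultimately show "eventually (\<lambda>x. a x \<noteq> 0 \<and> s x \<in> I \<and> r (s x) \<noteq> 0 \<and> r (s x) + m x * f0 (s x) * f2 (s x) \<noteq> 0) Fl"
    by eventually_elim auto
qed

lemma fibre_tendsto:
  assumes y: "y \<in> D"
  shows "(PhiV \<longlongrightarrow> PhiV y) (nhds y)" "(PsiV \<longlongrightarrow> PsiV y) (nhds y)" "(OmegaV \<longlongrightarrow> OmegaV y) (nhds y)"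
    "(m2 \<longlongrightarrow> m2 y) (nhds y)" "eventually (\<lambda>z. z \<in> D) (nhds y)"
proof -
  have y0: "y \<noteq> 0" using y by (simp add: D_iff)
  have a: "(al \<longlongrightarrow> al y) (nhds y)" using isCont_al by (simp add: isCont_def tendsto_at_iff_tendsto_nhds)
  have s: "(sv \<longlongrightarrow> sv y) (nhds y)" using isCont_sv[OF y0] by (simp add: isCont_def tendsto_at_iff_tendsto_nhds)
  show m: "(m2 \<longlongrightarrow> m2 y) (nhds y)" unfolding m2_def[abs_def] by (intro tendsto_intros s)
  have nz: "al y \<noteq> 0" "sv y \<in> I" "r (sv y) \<noteq> 0" "r (sv y) + m2 y * f0 (sv y) * f2 (sv y) \<noteq> 0"
    using y al_pos[OF y0] by (auto simp: D_iff Q_def)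
  note t = tendsto_quantities[OF a nz(1) s nz(2) m nz(3,4)]
  show "(PhiV \<longlongrightarrow> PhiV y) (nhds y)" "(PsiV \<longlongrightarrow> PsiV y) (nhds y)" "(OmegaV \<longlongrightarrow> OmegaV y) (nhds y)"
    by (rule t)+
  have "eventually (\<lambda>z. z \<noteq> 0) (nhds y)" by (rule t1_space_nhds[OF y0])
  with t(4) show "eventually (\<lambda>z. z \<in> D) (nhds y)" by eventually_elim (auto simp: D_iff Q_def)
qed

abbreviation "Aval y \<equiv> PhiV y + m2 y * PsiV y"
abbreviation "Bval y \<equiv> m2 y * OmegaV y + 3 * PsiV y"

lemma fibre_tendsto_ab:
  assumes y: "y \<in> D"
  shows "(Aval \<longlongrightarrow> Aval y) (nhds y)" "(Bval \<longlongrightarrow> Bval y) (nhds y)"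
  by (intro tendsto_intros fibre_tendsto[OF y])+

text \<open>Three functions, since T has three coefficients; shorter lists are obtained by repeating
  an entry.\<close>

lemma open_nonzero:
  fixes f g h :: "real^'n \<Rightarrow> real"
  assumes "\<And>y. y \<in> D \<Longrightarrow> (f \<longlongrightarrow> f y) (nhds y)" "\<And>y. y \<in> D \<Longrightarrow> (g \<longlongrightarrow> g y) (nhds y)"
    "\<And>y. y \<in> D \<Longrightarrow> (h \<longlongrightarrow> h y) (nhds y)"
  shows "open {y \<in> D. f y \<noteq> 0 \<or> g y \<noteq> 0 \<or> h y \<noteq> 0}" (is "open ?N")
proof (subst open_subopen, rule ballI)
  fix y assume "y \<in> ?N"
  then have y: "y \<in> D" and n: "f y \<noteq> 0 \<or> g y \<noteq> 0 \<or> h y \<noteq> 0" by auto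
  from n have "eventually (\<lambda>z. f z \<noteq> 0 \<or> g z \<noteq> 0 \<or> h z \<noteq> 0) (nhds y)"
    using tendsto_imp_eventually_ne[OF assms(1)[OF y], of 0] tendsto_imp_eventually_ne[OF assms(2)[OF y], of 0] tendsto_imp_eventually_ne[OF assms(3)[OF y], of 0]
    by (auto elim: eventually_mono)
  with fibre_tendsto(5)[OF y] have "eventually (\<lambda>z. z \<in> ?N) (nhds y)"
    by eventually_elim auto
  then show "\<exists>T. open T \<and> y \<in> T \<and> T \<subseteq> ?N" by (auto simp: eventually_nhds)
qed

lemma open_m2: "open {y \<in> D. m2 y \<noteq> 0}"
  using open_nonzero[of m2 m2 m2] fibre_tendsto(4) by simp

text \<open>A failure of (a) or (b) at one y spreads to an open set of y; where m^2 \<noteq> 0 on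
  it, only \<open>annih\<close> is left, and \<open>annih_open\<close> then gives \<tau> =
  0.\<close>

lemma fibre_ab:
  assumes z: "\<And>y i j k. y \<in> D \<Longrightarrow> contr \<tau> y i j k = 0" and "\<tau> \<noteq> 0" and y: "y \<in> D"
  shows "Aval y = 0 \<and> Bval y = 0"
proof (rule ccontr)
  assume n: "\<not> (Aval y = 0 \<and> Bval y = 0)"
  define N where "N = {y \<in> D. Aval y \<noteq> 0 \<or> Bval y \<noteq> 0 \<or> Bval y \<noteq> 0}"
  have N: "open N" unfolding N_def by (rule open_nonzero) (rule fibre_tendsto_ab, assumption)+
  have yN: "y \<in> N" using y n by (auto simp: N_def)
  have ND: "N \<subseteq> D" by (auto simp: N_def)
  have "w \<noteq> 0" using w_zero[OF _ y] n by auto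
  then obtain x where x: "x \<in> N" "m2 x \<noteq> 0" using m2_nonzero_dense[OF _ N _ ND] yN by blast
  have "annih \<tau> u" if "u \<in> N \<inter> {y \<in> D. m2 y \<noteq> 0}" for u
    using contr_zero_cases(1)[of u \<tau>] z that by (auto simp: N_def)
  then have "\<tau> = 0"
    using x ND by (intro annih_open[of "N \<inter> {y \<in> D. m2 y \<noteq> 0}"] open_Int N open_m2) auto
  then show False using \<open>\<tau> \<noteq> 0\<close> by simp
qed

text \<open>Otherwise the open set where some coefficient of T is nonzero can be shrunk until \<tau>
  avoids every span of w and G y, and only \<open>annih\<close> remains.\<close>

lemma fibre_parallel:
  assumes z: "\<And>y i j k. y \<in> D \<Longrightarrow> contr \<tau> y i j k = 0"
    and y: "y \<in> D" "T_tensor F l i j k y \<noteq> 0"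
  shows "\<tau> \<in> span {w}"
proof (rule ccontr)
  assume n: "\<tau> \<notin> span {w}"
  define N where "N = {y \<in> D. PhiV y \<noteq> 0 \<or> PsiV y \<noteq> 0 \<or> OmegaV y \<noteq> 0}"
  have N: "open N" unfolding N_def by (rule open_nonzero) (rule fibre_tendsto, assumption)+
  have yN: "y \<in> N" using y T_tensor_eq[OF y(1)] by (auto simp: N_def)
  have ND: "N \<subseteq> D" by (auto simp: N_def)
  have "w \<noteq> 0" using w_zero(4)[OF _ y(1)] y(2) by auto
  then obtain x where x: "x \<in> N" "m2 x \<noteq> 0" using m2_nonzero_dense[OF _ N _ ND] yN by blast
  have O: "open (N \<inter> {y \<in> D. m2 y \<noteq> 0})" "N \<inter> {y \<in> D. m2 y \<noteq> 0} \<noteq> {}" using N open_m2 x ND by auto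
  obtain N' where N': "open N'" "N' \<noteq> {}" "N' \<subseteq> N \<inter> {y \<in> D. m2 y \<noteq> 0}"
      "\<And>y. y \<in> N' \<Longrightarrow> \<tau> \<notin> span {w, G *v y}"
    by (rule open_avoids_combination[OF O n]) blast
  have "annih \<tau> u" if u: "u \<in> N'" for u
  proof -
    have uN: "u \<in> D" "m2 u \<noteq> 0" "\<not> (PhiV u = 0 \<and> PsiV u = 0 \<and> OmegaV u = 0)"
      using u N'(3) by (auto simp: N_def)
    show ?thesis using contr_zero_cases(2)[OF uN(1,2) z[OF uN(1)]] uN(3) N'(4)[OF u] by blast
  qed
  then have "\<tau> = 0" using N' by (intro annih_open[of N']) auto
  then show False using n by (simp add: span_zero)
qed

text \<open>Condition (c) says nothing where s = 0, so a direction with s \<noteq> 0 must exist. If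
  s vanished near y, so would its gradient m/\<alpha>, and then b = m + s \<open>av\<close> =
  0.\<close>

lemma exists_sv_nonzero:
  assumes w: "w \<noteq> 0" and y: "y \<in> D"
  obtains z where "z \<in> D" "sv z \<noteq> 0"
proof (rule ccontr)
  assume "\<not> thesis"
  then have z: "\<forall>z\<in>D. sv z = 0" using that by blast
  have y0: "y \<noteq> 0" using y by (simp add: D_iff)
  obtain V where V: "open V" "y \<in> V" "V \<subseteq> D"
    using fibre_tendsto(5)[OF y] unfolding eventually_nhds by blast
  have "mv y $ i = 0" for i
  proof -
    have "has_partial i sv 0 y"
      by (rule has_partial_transform[OF V(1,2) _ has_partial_const[of i 0]]) (use z V in auto)
    with has_partial_sv[OF y0] have "mv y $ i / al y = 0" by (rule has_partial_unique)
    then show ?thesis using al_pos[OF y0] by simp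
  qed
  then show False using w z y by (simp add: mv_def vec_eq_iff)
qed

end

section \<open>The $\sigma T$-condition on the manifold\<close>

lemma tendsto_det:
  fixes A :: "'a \<Rightarrow> real^'n::finite^'n"
  assumes "\<And>i j. ((\<lambda>x. A x $ i $ j) \<longlongrightarrow> B $ i $ j) Fl"
  shows "((\<lambda>x. det (A x)) \<longlongrightarrow> det B) Fl"
  unfolding det_def by (intro tendsto_intros assms)

text \<open>\<open>matrix_inv\<close> is defined by choice; continuity comes from Cramer's rule,
  which writes the solution as a quotient of determinants.\<close>

lemma tendsto_bsq:
  fixes A :: "'a \<Rightarrow> real^'n::finite^'n"
  assumes A: "\<And>i j. ((\<lambda>x. A x $ i $ j) \<longlongrightarrow> B $ i $ j) Fl"
    and w: "\<And>i. ((\<lambda>x. w x $ i) \<longlongrightarrow> v $ i) Fl"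
    and inv: "invertible B"
  shows "((\<lambda>x. bsq (A x) (w x)) \<longlongrightarrow> bsq B v) Fl"
proof -
  define sol :: "real^'n^'n \<Rightarrow> real^'n \<Rightarrow> 'n \<Rightarrow> real" where
    "sol M u k = det (\<chi> i j. if j = k then u $ i else M $ i $ j) / det M" for M u k
  have eq: "bsq M u = (\<Sum>k\<in>UNIV. u $ k * sol M u k)" if "det M \<noteq> 0" for M and u :: "real^'n"
  proof -
    have "M *v (matrix_inv M *v u) = u"
      using that matrix_inv_invertible(1)[of M]
      by (simp add: invertible_det_nz matrix_vector_mul_assoc)
    then have "matrix_inv M *v u = (\<chi> k. sol M u k)"
      using cramer[OF that] by (simp add: sol_def)
    moreover have "bsq M u = u \<bullet> (matrix_inv M *v u)"
      by (simp add: bsq_def inner_vec_def matrix_vector_mult_def sum_distrib_left mult_ac)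
    ultimately show ?thesis by (simp add: inner_vec_def)
  qed
  have dB: "det B \<noteq> 0" using inv by (simp add: invertible_det_nz)
  have d: "((\<lambda>x. det (A x)) \<longlongrightarrow> det B) Fl" by (rule tendsto_det[OF A])
  have "((\<lambda>x. det (\<chi> i j. if j = k then w x $ i else A x $ i $ j)) \<longlongrightarrow>
      det (\<chi> i j. if j = k then v $ i else B $ i $ j)) Fl" for k
    by (rule tendsto_det) (use A w in simp)
  then have "((\<lambda>x. \<Sum>k\<in>UNIV. w x $ k * sol (A x) (w x) k) \<longlongrightarrow> (\<Sum>k\<in>UNIV. v $ k * sol B v k)) Fl"
    unfolding sol_def by (intro tendsto_intros w d dB)
  then have "((\<lambda>x. \<Sum>k\<in>UNIV. w x $ k * sol (A x) (w x) k) \<longlongrightarrow> bsq B v) Fl"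
    by (simp add: eq[OF dB])
  then show ?thesis
    by (rule Lim_transform_eventually)
      (use tendsto_imp_eventually_ne[OF d dB] in \<open>auto simp: eq elim: eventually_mono\<close>)
qed

lemma partial_of_derivative:
  assumes "(f has_derivative f') (at x)"
  shows "partial i f x = f' (axis i 1)"
proof (rule partial_eqI)
  have "((\<lambda>t. x + t *\<^sub>R axis i 1) has_derivative (\<lambda>h. h *\<^sub>R axis i 1)) (at 0)"
    by (auto intro!: derivative_eq_intros)
  then have "((\<lambda>t. f (x + t *\<^sub>R axis i 1)) has_derivative (\<lambda>h. f' (h *\<^sub>R axis i 1))) (at 0)"
    by (rule has_derivative_compose) (use assms in simp)
  moreover have "(\<lambda>h. f' (h *\<^sub>R axis i 1)) = (*) (f' (axis i 1))"
    using linear_scale[OF has_derivative_linear[OF assms]] by (simp add: fun_eq_iff mult.commute)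
  ultimately show "has_partial i f (f' (axis i 1)) x"
    by (simp add: has_partial_def has_field_derivative_def)
qed

lemma zero_partials_constant:
  fixes f :: "real^'n::finite \<Rightarrow> real"
  assumes "convex B" "\<And>x. x \<in> B \<Longrightarrow> f differentiable (at x)" "\<And>x i. x \<in> B \<Longrightarrow> partial i f x = 0"
  shows "\<exists>c. \<forall>x\<in>B. f x = c"
proof (rule has_derivative_zero_constant[OF assms(1)])
  fix x assume x: "x \<in> B"
  then obtain f' where f': "(f has_derivative f') (at x)" using assms(2) by (auto simp: differentiable_def)
  have "f' u = 0" for u
  proof -
    have "f' u = f' (\<Sum>i\<in>UNIV. u $ i *\<^sub>R axis i 1)" by (simp add: basis_expansion scalar_mult_eq_scaleR[symmetric])
    also have "\<dots> = (\<Sum>i\<in>UNIV. u $ i *\<^sub>R f' (axis i 1))"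
      using has_derivative_linear[OF f'] by (simp add: linear_sum linear_scale)
    finally show ?thesis using assms(3)[OF x] partial_of_derivative[OF f'] by simp
  qed
  then have "f' = (\<lambda>_. 0)" by auto
  then show "(f has_derivative (\<lambda>_. 0)) (at x within B)" using f' has_derivative_at_withinI by blast
qed

locale ab_manifold =
  fixes A :: "('m::{t2_space,second_countable_topology}, 'n::finite) chart set"
    and a :: "('m, 'n) chart \<Rightarrow> real^'n \<Rightarrow> real^'n^'n"
    and b :: "('m, 'n) chart \<Rightarrow> real^'n \<Rightarrow> real^'n"
    and b0 :: real and I :: "real set" and \<phi> :: "real \<Rightarrow> real" and \<sigma> :: "'m \<Rightarrow> real"
  assumes card3: "CARD('n) \<ge> 3"
    and space: "ab_space A a b b0 I \<phi>"
    and smooth_sigma: "smooth_fun A \<sigma>"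
    and nlc: "nowhere_locally_constant \<sigma>"
    and T_nlz: "T_nowhere_locally_zero A a b I \<phi>"
begin

definition gr :: "('m, 'n) chart \<Rightarrow> real^'n \<Rightarrow> real^'n" where "gr c x = (\<chi> h. grad c \<sigma> h x)"

lemma fibre: "c \<in> A \<Longrightarrow> x \<in> chart_image c \<Longrightarrow> ab_fibre (a c x) I \<phi>"
  using space card3 unfolding ab_space_def riemannian_metric_def ab_function_def
  by unfold_locales auto

lemma tendsto_components:
  assumes c: "c \<in> A" and x: "x \<in> chart_image c"
  shows "((\<lambda>z. a c z $ i $ j) \<longlongrightarrow> a c x $ i $ j) (nhds x)"
    "((\<lambda>z. b c z $ i) \<longlongrightarrow> b c x $ i) (nhds x)"
    "((\<lambda>z. gr c z $ i) \<longlongrightarrow> gr c x $ i) (nhds x)"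
proof -
  have op: "open (chart_image c)" using space c by (auto simp: ab_space_def smooth_atlas_def)
  have t: "(f \<longlongrightarrow> f x) (nhds x)" if "continuous_on (chart_image c) f" for f :: "real^'n \<Rightarrow> real"
    using that op x by (simp add: continuous_on_eq_continuous_at isCont_def tendsto_at_iff_tendsto_nhds)
  have "smooth_on (chart_image c) (\<lambda>x. a c x $ i $ j)" "smooth_on (chart_image c) (\<lambda>x. b c x $ i)"
    using space c by (auto simp: ab_space_def riemannian_metric_def one_form_def)
  then have "Ck_on 0 (chart_image c) (\<lambda>x. a c x $ i $ j)" "Ck_on 0 (chart_image c) (\<lambda>x. b c x $ i)"
    unfolding smooth_on_def by blast+
  then show "((\<lambda>z. a c z $ i $ j) \<longlongrightarrow> a c x $ i $ j) (nhds x)"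
    "((\<lambda>z. b c z $ i) \<longlongrightarrow> b c x $ i) (nhds x)" by (auto intro: t)
  have "Ck_on (Suc 0) (chart_image c) (\<sigma> \<circ> chart_inv c)"
    using smooth_sigma c unfolding smooth_fun_def smooth_on_def by blast
  then have "continuous_on (chart_image c) (\<lambda>z. gr c z $ i)"
    by (simp add: gr_def grad_def[abs_def])
  then show "((\<lambda>z. gr c z $ i) \<longlongrightarrow> gr c x $ i) (nhds x)" by (rule t)
qed

lemma chart_preimage:
  assumes c: "c \<in> A" and V: "open V" "V \<noteq> {}" "V \<subseteq> chart_image c"
  defines "W \<equiv> fst c \<inter> snd c -` V"
  shows "open W" "W \<noteq> {}" "W \<subseteq> fst c" "\<And>p. p \<in> W \<Longrightarrow> chart_inv c (snd c p) = p"
proof -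
  have h: "homeomorphism (fst c) (chart_image c) (snd c) (chart_inv c)" and o: "open (fst c)"
    using space c by (auto simp: ab_space_def smooth_atlas_def)
  show "open W" unfolding W_def
    using continuous_open_preimage[OF homeomorphism_cont1[OF h] o V(1)] .
  show "W \<subseteq> fst c" by (auto simp: W_def)
  show "W \<noteq> {}" using V by (auto simp: W_def chart_image_def)
  show "\<And>p. p \<in> W \<Longrightarrow> chart_inv c (snd c p) = p"
    using homeomorphism_apply1[OF h] by (auto simp: W_def)
qed

text \<open>A gradient vanishing on V makes \<sigma> constant on a coordinate ball in V, whose
  preimage is a nonempty open subset of the manifold.\<close>

lemma gr_dense:
  assumes c: "c \<in> A" and V: "open V" "V \<noteq> {}" "V \<subseteq> chart_image c"
  obtains x where "x \<in> V" "gr c x \<noteq> 0"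
proof (rule ccontr)
  assume "\<not> thesis"
  then have z: "\<forall>x\<in>V. gr c x = 0" using that by blast
  obtain x0 where "x0 \<in> V" using V(2) by blast
  then obtain e where e: "e > 0" "ball x0 e \<subseteq> V" by (rule openE[OF V(1)])
  have "Ck_on (Suc 0) (chart_image c) (\<sigma> \<circ> chart_inv c)"
    using smooth_sigma c unfolding smooth_fun_def smooth_on_def by blast
  then have "\<And>x. x \<in> ball x0 e \<Longrightarrow> (\<sigma> \<circ> chart_inv c) differentiable (at x)"
    using e V(3) unfolding Ck_on.simps by blast
  moreover have "\<And>x i. x \<in> ball x0 e \<Longrightarrow> partial i (\<sigma> \<circ> chart_inv c) x = 0"
    using e z by (force simp: gr_def grad_def vec_eq_iff)
  ultimately have "\<exists>r. \<forall>x\<in>ball x0 e. (\<sigma> \<circ> chart_inv c) x = r"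
    by (rule zero_partials_constant[OF convex_ball])
  then obtain r where r: "\<And>x. x \<in> ball x0 e \<Longrightarrow> \<sigma> (chart_inv c x) = r" by auto
  have B: "open (ball x0 e)" "ball x0 e \<noteq> {}" "ball x0 e \<subseteq> chart_image c" using e V(3) by auto
  note W = chart_preimage[OF c B]
  have "\<sigma> p = r" if "p \<in> fst c \<inter> snd c -` ball x0 e" for p
    using r[of "snd c p"] W(4)[OF that] that by simp
  then show False using nlc W(1,2) unfolding nowhere_locally_constant_def by blast
qed

lemma T_dense:
  assumes c: "c \<in> A" and V: "open V" "V \<noteq> {}" "V \<subseteq> chart_image c"
  obtains x y l i j k where "x \<in> V" "y \<in> ab_domain I \<phi> (a c x) (b c x)"
    "T_tensor (ab_metric \<phi> (a c x) (b c x)) l i j k y \<noteq> 0"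
proof -
  note W = chart_preimage[OF c V]
  have "open (fst c \<inter> snd c -` V) \<and> fst c \<inter> snd c -` V \<noteq> {} \<and> fst c \<inter> snd c -` V \<subseteq> fst c"
    using W(1-3) by blast
  from T_nlz[unfolded T_nowhere_locally_zero_def, rule_format, OF c this]
  show ?thesis using that by (auto simp: Let_def)
qed

lemma open_nonzero_nbhd:
  fixes f :: "real^'n \<Rightarrow> real"
  assumes "c \<in> A" "x \<in> chart_image c" "(f \<longlongrightarrow> f x) (nhds x)" "f x \<noteq> 0" "eventually P (nhds x)"
  obtains V where "open V" "V \<noteq> {}" "V \<subseteq> chart_image c" "\<And>z. z \<in> V \<Longrightarrow> f z \<noteq> 0 \<and> P z"
proof -
  have op: "open (chart_image c)" using space assms(1) by (auto simp: ab_space_def smooth_atlas_def)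
  then have "eventually (\<lambda>z. z \<in> chart_image c) (nhds x)" using assms(2) by (auto simp: eventually_nhds)
  with assms(5) tendsto_imp_eventually_ne[OF assms(3,4)]
  have "eventually (\<lambda>z. z \<in> chart_image c \<and> f z \<noteq> 0 \<and> P z) (nhds x)" by eventually_elim auto
  then show ?thesis unfolding eventually_nhds using that by blast
qed

abbreviation "vdom c x \<equiv> ab_domain I \<phi> (a c x) (b c x)"
abbreviation "Phix c y x \<equiv> Phi \<phi> (bsq (a c x) (b c x) - (sval (a c x) (b c x) y)\<^sup>2) (alpha (a c x) y) (sval (a c x) (b c x) y)"
abbreviation "Psix c y x \<equiv> Psi \<phi> (bsq (a c x) (b c x) - (sval (a c x) (b c x) y)\<^sup>2) (alpha (a c x) y) (sval (a c x) (b c x) y)"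
abbreviation "Omegax c y x \<equiv> Omega \<phi> (bsq (a c x) (b c x) - (sval (a c x) (b c x) y)\<^sup>2) (alpha (a c x) y) (sval (a c x) (b c x) y)"
abbreviation "Ax c y x \<equiv> Phix c y x + (bsq (a c x) (b c x) - (sval (a c x) (b c x) y)\<^sup>2) * Psix c y x"
abbreviation "Bx c y x \<equiv> (bsq (a c x) (b c x) - (sval (a c x) (b c x) y)\<^sup>2) * Omegax c y x + 3 * Psix c y x"

text \<open>The coordinate vector y is frozen while x moves; the conditions defining its
  admissibility are open in x as well.\<close>

lemma base_tendsto:
  assumes c: "c \<in> A" and x: "x \<in> chart_image c" and y: "y \<in> vdom c x"
  shows "(Ax c y \<longlongrightarrow> Ax c y x) (nhds x)" "(Bx c y \<longlongrightarrow> Bx c y x) (nhds x)"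
    "eventually (\<lambda>z. y \<in> vdom c z) (nhds x)"
proof -
  interpret fx: ab_fibre "a c x" "b c x" I \<phi> by (rule fibre[OF c x])
  have yD: "y \<in> fx.D" using y by (simp add: fx.D_def)
  then have y0: "y \<noteq> 0" by (simp add: fx.D_iff)
  note t = tendsto_components[OF c x]
  have al: "((\<lambda>z. alpha (a c z) y) \<longlongrightarrow> alpha (a c x) y) (nhds x)"
    unfolding alpha_def by (intro tendsto_intros t)
  have al0: "alpha (a c x) y \<noteq> 0" using fx.al_pos[OF y0] by simp
  have s: "((\<lambda>z. sval (a c z) (b c z) y) \<longlongrightarrow> sval (a c x) (b c x) y) (nhds x)"
    unfolding sval_def beta_def by (intro tendsto_intros t al al0)
  have m: "((\<lambda>z. bsq (a c z) (b c z) - (sval (a c z) (b c z) y)\<^sup>2) \<longlongrightarrow>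
      bsq (a c x) (b c x) - (sval (a c x) (b c x) y)\<^sup>2) (nhds x)"
    by (intro tendsto_intros s tendsto_bsq t fx.inv_G)
  have nz: "sval (a c x) (b c x) y \<in> I" "rho \<phi> (sval (a c x) (b c x) y) \<noteq> 0"
    "rho \<phi> (sval (a c x) (b c x) y) + (bsq (a c x) (b c x) - (sval (a c x) (b c x) y)\<^sup>2)
      * \<phi> (sval (a c x) (b c x) y) * deriv (deriv \<phi>) (sval (a c x) (b c x) y) \<noteq> 0"
    using yD by (auto simp: fx.D_iff fx.Q_def fx.m2_def)
  note q = fx.tendsto_quantities[OF al al0 s nz(1) m nz(2,3)]
  show "(Ax c y \<longlongrightarrow> Ax c y x) (nhds x)" "(Bx c y \<longlongrightarrow> Bx c y x) (nhds x)"
    by (intro tendsto_intros q m)+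
  have "open (chart_image c)" using space c by (auto simp: ab_space_def smooth_atlas_def)
  then have "eventually (\<lambda>z. z \<in> chart_image c) (nhds x)" using x by (auto simp: eventually_nhds)
  with q(4) show "eventually (\<lambda>z. y \<in> vdom c z) (nhds x)"
  proof eventually_elim
    case (elim z)
    interpret fz: ab_fibre "a c z" "b c z" I \<phi> by (rule fibre[OF c elim(2)])
    have "y \<in> fz.D" using elim(1) y0 by (auto simp: fz.D_iff fz.Q_def fz.m2_def)
    then show ?case by (simp add: fz.D_def)
  qed
qed

lemma sigma_T_iff:
  "sigma_T_condition A a b I \<phi> \<sigma> \<longleftrightarrow>
    (\<forall>c\<in>A. \<forall>x\<in>chart_image c. \<forall>y\<in>vdom c x. \<forall>i j k. ab_fibre.contr (a c x) (b c x) \<phi> (gr c x) y i j k = 0)"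
  unfolding sigma_T_condition_def
  by (intro ball_cong refl) (simp add: ab_fibre.contr_def[OF fibre] gr_def)

text \<open>If (a) or (b) failed at (x, y), it would fail for the same y at all nearby x, and one of
  these has nonzero gradient.\<close>

lemma sigma_T_imp_ab:
  assumes sT: "sigma_T_condition A a b I \<phi> \<sigma>" and c: "c \<in> A" and x: "x \<in> chart_image c" and y: "y \<in> vdom c x"
  shows "Ax c y x = 0" "Bx c y x = 0"
proof -
  have at: "Ax c y z = 0 \<and> Bx c y z = 0" if "z \<in> chart_image c" "gr c z \<noteq> 0" "y \<in> vdom c z" for z
  proof -
    interpret fz: ab_fibre "a c z" "b c z" I \<phi> by (rule fibre[OF c that(1)])
    show ?thesis
      using fz.fibre_ab[of "gr c z" y] sT c that by (auto simp: sigma_T_iff fz.D_def fz.m2_def)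
  qed
  note t = base_tendsto[OF c x y]
  show "Ax c y x = 0"
  proof (rule ccontr)
    assume "Ax c y x \<noteq> 0"
    from open_nonzero_nbhd[OF c x t(1) this t(3)] obtain V where V: "open V" "V \<noteq> {}" "V \<subseteq> chart_image c"
      "\<And>z. z \<in> V \<Longrightarrow> Ax c y z \<noteq> 0 \<and> y \<in> vdom c z" by blast
    from gr_dense[OF c V(1-3)] obtain z where "z \<in> V" "gr c z \<noteq> 0" by blast
    then show False using at[of z] V(3,4) by blast
  qed
  show "Bx c y x = 0"
  proof (rule ccontr)
    assume "Bx c y x \<noteq> 0"
    from open_nonzero_nbhd[OF c x t(2) this t(3)] obtain V where V: "open V" "V \<noteq> {}" "V \<subseteq> chart_image c"
      "\<And>z. z \<in> V \<Longrightarrow> Bx c y z \<noteq> 0 \<and> y \<in> vdom c z" by blast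
    from gr_dense[OF c V(1-3)] obtain z where "z \<in> V" "gr c z \<noteq> 0" by blast
    then show False using at[of z] V(3,4) by blast
  qed
qed

text \<open>Proportionality is expressed by 2x2 minors because they are continuous in x, whereas the
  factor is undetermined at zeros of b.\<close>

lemma sigma_T_imp_proportional:
  assumes sT: "sigma_T_condition A a b I \<phi> \<sigma>" and c: "c \<in> A" and x: "x \<in> chart_image c"
  shows "gr c x $ j * b c x $ k = gr c x $ k * b c x $ j"
proof (rule ccontr)
  assume "\<not> ?thesis"
  then have n: "gr c x $ j * b c x $ k - gr c x $ k * b c x $ j \<noteq> 0" by simp
  note t = tendsto_components[OF c x]
  have "((\<lambda>x. gr c x $ j * b c x $ k - gr c x $ k * b c x $ j) \<longlongrightarrow> gr c x $ j * b c x $ k - gr c x $ k * b c x $ j) (nhds x)"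
    by (intro tendsto_intros t)
  from open_nonzero_nbhd[OF c x this n, of "\<lambda>_. True"] obtain V where V: "open V" "V \<noteq> {}" "V \<subseteq> chart_image c"
    "\<And>z. z \<in> V \<Longrightarrow> gr c z $ j * b c z $ k - gr c z $ k * b c z $ j \<noteq> 0" by auto
  from T_dense[OF c V(1-3)] obtain z y l i' j' k' where z: "z \<in> V" "y \<in> vdom c z"
    "T_tensor (ab_metric \<phi> (a c z) (b c z)) l i' j' k' y \<noteq> 0" by blast
  interpret fz: ab_fibre "a c z" "b c z" I \<phi> by (rule fibre[OF c]) (use V z in blast)
  have "gr c z \<in> span {b c z}"
    by (rule fz.fibre_parallel[of _ y l i' j' k']) (use sT c z V(3) in \<open>auto simp: sigma_T_iff fz.D_def\<close>)
  then obtain t where "gr c z = t *\<^sub>R b c z" by (auto simp: span_singleton)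
  then show False using V(4)[OF z(1)] by simp
qed

lemma sigma_T_imp_c:
  assumes sT: "sigma_T_condition A a b I \<phi> \<sigma>"
  shows "condition_c A a b I \<phi> \<sigma>"
  unfolding condition_c_def Let_def
proof (intro ballI impI allI)
  fix c x y j
  assume c: "c \<in> A" and x: "x \<in> chart_image c" and y: "y \<in> vdom c x" and s: "sval (a c x) (b c x) y \<noteq> 0"
  interpret fx: ab_fibre "a c x" "b c x" I \<phi> by (rule fibre[OF c x])
  have y0: "y \<noteq> 0" using y by (simp add: ab_domain_def)
  have d: "sval (a c x) (b c x) y * alpha (a c x) y = (\<Sum>i\<in>UNIV. b c x $ i * y $ i)"
    using fx.al_pos[OF y0] by (simp add: sval_def beta_def)
  \<comment> \<open>Contracting \<sigma>_i b_j = \<sigma>_j b_i with y^i gives \<sigma>_0 b_j =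
    s\<alpha> \<sigma>_j.\<close>
  have "(\<Sum>i\<in>UNIV. grad c \<sigma> i x * y $ i) * b c x $ j = (\<Sum>i\<in>UNIV. (gr c x $ i * b c x $ j) * y $ i)"
    by (simp add: sum_distrib_right sum_distrib_left gr_def mult_ac)
  also have "\<dots> = (\<Sum>i\<in>UNIV. (gr c x $ j * b c x $ i) * y $ i)"
    by (simp only: sigma_T_imp_proportional[OF sT c x, of _ j])
  also have "\<dots> = gr c x $ j * (sval (a c x) (b c x) y * alpha (a c x) y)"
    unfolding d by (simp add: sum_distrib_left mult_ac)
  finally show "grad c \<sigma> j x - (\<Sum>i\<in>UNIV. grad c \<sigma> i x * y $ i) / (sval (a c x) (b c x) y * alpha (a c x) y) * b c x $ j = 0"
    using s fx.al_pos[OF y0] by (simp add: gr_def)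
qed

lemma abc_imp_sigma_T:
  assumes ca: "condition_a A a b I \<phi>" and cb: "condition_b A a b I \<phi>" and cc: "condition_c A a b I \<phi> \<sigma>"
  shows "sigma_T_condition A a b I \<phi> \<sigma>"
  unfolding sigma_T_iff
proof (intro ballI allI)
  fix c x y i j k
  assume c: "c \<in> A" and x: "x \<in> chart_image c" and y: "y \<in> vdom c x"
  interpret fx: ab_fibre "a c x" "b c x" I \<phi> by (rule fibre[OF c x])
  have yD: "y \<in> fx.D" using y by (simp add: fx.D_def)
  show "fx.contr (gr c x) y i j k = 0"
  proof (cases "b c x = 0")
    case True
    show ?thesis unfolding fx.contr_def T_up_def fx.w_zero(4)[OF True yD] by simp
  next
    case False
    obtain z where z: "z \<in> fx.D" "sval (a c x) (b c x) z \<noteq> 0" by (rule fx.exists_sv_nonzero[OF False yD])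
    \<comment> \<open>The factor is read off at z rather than at y, since s may vanish at y.\<close>
    define t where "t = (\<Sum>i\<in>UNIV. grad c \<sigma> i x * z $ i) / (sval (a c x) (b c x) z * alpha (a c x) z)"
    have "gr c x = t *\<^sub>R b c x"
      using cc c x z by (simp add: condition_c_def Let_def fx.D_def vec_eq_iff gr_def t_def)
    moreover have "fx.Aval y = 0" "fx.Bval y = 0"
      using ca cb c x y by (simp_all add: condition_a_def condition_b_def Let_def fx.m2_def)
    ultimately show ?thesis by (intro fx.contr_zero_parallel[OF yD])
  qed
qed

end

theorem theorem3p3:
  fixes A :: "('m::{t2_space,second_countable_topology}, 'n::finite) chart set"
    and a :: "('m, 'n) chart \<Rightarrow> real^'n \<Rightarrow> real^'n^'n"
    and b :: "('m, 'n) chart \<Rightarrow> real^'n \<Rightarrow> real^'n"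
    and b0 :: real and I :: "real set" and \<phi> :: "real \<Rightarrow> real"
    and \<sigma> :: "'m \<Rightarrow> real"
  assumes "CARD('n) \<ge> 3"
    and "ab_space A a b b0 I \<phi>"
    and "smooth_fun A \<sigma>"
    and "nowhere_locally_constant \<sigma>"
    and "T_nowhere_locally_zero A a b I \<phi>"
  shows "sigma_T_condition A a b I \<phi> \<sigma> \<longleftrightarrow>
           condition_a A a b I \<phi> \<and> condition_b A a b I \<phi> \<and> condition_c A a b I \<phi> \<sigma>"
proof -
  interpret ab_manifold A a b b0 I \<phi> \<sigma> by unfold_locales (fact assms)+
  show ?thesis
  proof
    assume sT: "sigma_T_condition A a b I \<phi> \<sigma>"
    then show "condition_a A a b I \<phi> \<and> condition_b A a b I \<phi> \<and> condition_c A a b I \<phi> \<sigma>"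
      using sigma_T_imp_ab[OF sT] sigma_T_imp_c[OF sT]
      by (simp add: condition_a_def condition_b_def Let_def)
  qed (use abc_imp_sigma_T in blast)
qed

end
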